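(* Let $(K,\nu)$ be a valued field of arbitrary rank with valuation ring $R_\nu$, maximal ideal $M_\nu$, residue field $k_\nu=R_\nu/M_\nu$ and value group $\Gamma_\nu$. Let $f\in R_\nu[X]$ be a monic irreducible separable polynomial, $\alpha$ a root of $f$ in an algebraic closure of $K$, and $L=K(\alpha)$. Let $\overline{f}=\prod_{i=1}^s \overline{\phi_i}^{\,l_i}$ be the factorization of $\overline{f}$ into powers of distinct monic irreducible polynomials over $k_\nu$, and let $\phi_i\in R_\nu[X]$ be a monic lifting of $\overline{\phi_i}$ for $i=1,\dots,s$. For each $i$, let $r_i\in R_\nu[X]$ be the remainder upon Euclidean division of $f$ by $\phi_i$. (i) If $l_i=1$ for all $i=1,\dots,s$, then $R_\nu[\alpha]$ is integrally closed. (ii) If $I=\{i\in\{1,\dots,s\} : l_i\ge 2\}$ is nonempty, then $R_\nu[\alpha]$ is integrally closed if and only if $\Gamma_\nu^+$ has a minimum element and $\nu^{G}(r_i)=\min(\Gamma_\nu^+)$ for every $i\in I$.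
   Context: $\Gamma_\nu^+=\{g\in\Gamma_\nu: g>0\}$, and $\min(\Gamma_\nu^+)$ denotes its minimum element when it exists. $\nu^{G}$ denotes the Gaussian extension of $\nu$: for $h=\sum_j a_jX^j\in K[X]$, $\nu^{G}(h)=\min_j \nu(a_j)$. Bars denote reduction modulo $M_\nu$. "Integrally closed" means $R_\nu[\alpha]$ equals the integral closure of $R_\nu$ in $L$. *)

theory Defs
  imports "HOL-Library.Extended" "HOL-Algebra.Algebraic_Closure_Type"
begin

text \<open>
  Valuations are written additively, with \<^term>\<open>Pinf\<close> as the value of zero. The type of values may be
  larger than the value group, which is the set \<open>value_group\<close> below. No condition is put on the
  ordered group, so the rank is arbitrary.
\<close>

locale valuation =
  fixes \<nu> :: "'k::field \<Rightarrow> 'g::linordered_ab_group_add extended"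
  assumes val_not_Minf: "\<nu> x \<noteq> Minf"
    and val_eq_Pinf_iff: "\<nu> x = Pinf \<longleftrightarrow> x = 0"
    and val_mult: "\<nu> (x * y) = \<nu> x + \<nu> y"
    and val_add: "min (\<nu> x) (\<nu> y) \<le> \<nu> (x + y)"

definition valuation_ring ::
    "('k::field \<Rightarrow> 'g::linordered_ab_group_add extended) \<Rightarrow> 'k set" where
  "valuation_ring \<nu> = {x. 0 \<le> \<nu> x}"

definition valuation_ideal ::
    "('k::field \<Rightarrow> 'g::linordered_ab_group_add extended) \<Rightarrow> 'k set" where
  "valuation_ideal \<nu> = {x. 0 < \<nu> x}"

definition value_group ::
    "('k::field \<Rightarrow> 'g::linordered_ab_group_add extended) \<Rightarrow> 'g set" where
  "value_group \<nu> = {g. \<exists>x. x \<noteq> 0 \<and> \<nu> x = Fin g}"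

definition pos_value_group ::
    "('k::field \<Rightarrow> 'g::linordered_ab_group_add extended) \<Rightarrow> 'g set" where
  "pos_value_group \<nu> = {g \<in> value_group \<nu>. 0 < g}"

definition gauss_extension ::
    "('k::field \<Rightarrow> 'g::linordered_ab_group_add extended) \<Rightarrow> 'k poly \<Rightarrow> 'g extended" where
  "gauss_extension \<nu> h = (MIN j\<in>{..Polynomial.degree h}. \<nu> (poly.coeff h j))"

text \<open>
  The residue field is the quotient of the valuation ring by its maximal ideal. It depends on the
  valuation and so cannot be a type constructed from it; it is given as a field type together with
  the canonical projection, a ring homomorphism from the valuation ring onto the field whose kernel
  is the maximal ideal. Values of the projection outside the valuation ring are irrelevant.
\<close>

definition residue_map ::
    "('k::field \<Rightarrow> 'g::linordered_ab_group_add extended) \<Rightarrow> ('k \<Rightarrow> 'r::field) \<Rightarrow> bool" where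
  "residue_map \<nu> res \<longleftrightarrow>
     res 1 = 1 \<and>
     (\<forall>x\<in>valuation_ring \<nu>. \<forall>y\<in>valuation_ring \<nu>. res (x + y) = res x + res y) \<and>
     (\<forall>x\<in>valuation_ring \<nu>. \<forall>y\<in>valuation_ring \<nu>. res (x * y) = res x * res y) \<and>
     res ` valuation_ring \<nu> = UNIV \<and>
     {x \<in> valuation_ring \<nu>. res x = 0} = valuation_ideal \<nu>"

definition polys_over :: "'k::field set \<Rightarrow> 'k poly set" where
  "polys_over R = {h. \<forall>n. poly.coeff h n \<in> R}"

abbreviation eval_ac :: "'k::field poly \<Rightarrow> 'k alg_closure \<Rightarrow> 'k alg_closure" where
  "eval_ac h x \<equiv> poly (map_poly to_ac h) x"

definition adjoin_ring :: "'k::field set \<Rightarrow> 'k alg_closure \<Rightarrow> 'k alg_closure set" where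
  "adjoin_ring R \<alpha> = {eval_ac h \<alpha> | h. h \<in> polys_over R}"

definition is_subfield :: "'a::field set \<Rightarrow> bool" where
  "is_subfield F \<longleftrightarrow>
     0 \<in> F \<and> 1 \<in> F \<and>
     (\<forall>x\<in>F. \<forall>y\<in>F. x + y \<in> F \<and> x * y \<in> F) \<and>
     (\<forall>x\<in>F. - x \<in> F \<and> inverse x \<in> F)"

definition adjoin_field :: "'k::field alg_closure \<Rightarrow> 'k alg_closure set" where
  "adjoin_field \<alpha> = \<Inter>{F. is_subfield F \<and> range to_ac \<subseteq> F \<and> \<alpha> \<in> F}"

definition integral_over :: "'k::field set \<Rightarrow> 'k alg_closure \<Rightarrow> bool" where
  "integral_over R x \<longleftrightarrow> (\<exists>p\<in>polys_over R. lead_coeff p = 1 \<and> eval_ac p x = 0)"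

definition integral_closure_in ::
    "'k::field set \<Rightarrow> 'k alg_closure set \<Rightarrow> 'k alg_closure set" where
  "integral_closure_in R L = {x \<in> L. integral_over R x}"

text \<open>Separability means that all roots in an algebraic closure are simple.\<close>

definition separable_poly :: "'k::field poly \<Rightarrow> bool" where
  "separable_poly f \<longleftrightarrow> rsquarefree (map_poly to_ac f)"

end

theory Submission
  imports Defs "Jordan_Normal_Form.Char_Poly"
begin

text \<open>
  Write \<open>A = R[\<alpha>]\<close>, \<open>f = \<phi>\<^sub>i q\<^sub>i + r\<^sub>i\<close>, and let bars denote reduction to the residue field.

  Suppose that \<open>x \<in> L\<close> is integral but not in \<open>A\<close>. Then \<open>x = g(\<alpha>) / c\<close> with \<open>c\<close> in the maximal ideal
  and \<open>g\<close> over \<open>R\<close> whose reduction is not divisible by that of \<open>f\<close>. Multiplying \<open>g\<close> by a suitable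
  polynomial (Bezout over the residue field) one may assume that \<open>g\<close> and some \<open>q\<^sub>i\<close> agree modulo \<open>f\<close>
  after reduction. A monic relation for \<open>g(\<alpha>) / c\<close> shows that \<open>f\<close> divides a power of \<open>g\<close> after
  reduction, which forces \<open>l\<^sub>i \<ge> 2\<close>. If \<open>c = \<pi>\<close> generates the maximal ideal and \<open>b = g(\<alpha>) / \<pi>\<close>, then
  \<open>\<phi>\<^sub>i(\<alpha>) b\<close> is, up to sign and multiples of \<open>\<phi>\<^sub>i(\<alpha>)\<close>, the value of \<open>r\<^sub>i / \<pi>\<close> at \<open>\<alpha>\<close>, and clearing
  denominators in a monic relation for \<open>b\<close> shows that the reduction of \<open>\<phi>\<^sub>i\<close> divides that of \<open>r\<^sub>i / \<pi>\<close>;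
  since the latter has smaller degree, it vanishes.

  Conversely, let \<open>l\<^sub>i \<ge> 2\<close> and \<open>q\<^sub>i = \<phi>\<^sub>i p + t\<close>, so that \<open>t\<close> reduces to zero. If some \<open>c\<close> in the maximal
  ideal is such that \<open>c\<close> divides \<open>t\<close> and \<open>c\<^sup>2\<close> divides \<open>r\<^sub>i\<close>, then \<open>b = q\<^sub>i(\<alpha>) / c\<close> is not in \<open>A\<close>, but it is
  integral because \<open>b\<^sup>2 = (t / c)(\<alpha>) b - (r\<^sub>i / c\<^sup>2)(\<alpha>) p(\<alpha>)\<close>. Such a \<open>c\<close> exists unless the value group has
  a least positive element and the Gaussian value of \<open>r\<^sub>i\<close> equals it.
\<close>

section \<open>The embedding into the algebraic closure, and divisibility of polynomials over a
  field\<close>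

interpretation to_ac: map_poly_inj_idom_hom to_ac
  by unfold_locales (auto)

text \<open>Euclid's algorithm, by induction on the size of the second argument: a combination for
  \<open>b\<close> and \<open>a mod b\<close> is also one for \<open>a\<close> and \<open>b\<close>.
  The resulting common divisor is not normalised.\<close>

lemma poly_bezout:
  fixes a b :: "'a::field poly"
  shows "\<exists>u v. u * a + v * b dvd a \<and> u * a + v * b dvd b"
proof (induction b arbitrary: a rule: measure_induct_rule[where f = euclidean_size])
  case (less b)
  show ?case
  proof (cases "b = 0")
    case True
    then have "1 * a + 0 * b dvd a \<and> 1 * a + 0 * b dvd b"
      by simp
    then show ?thesis
      by blast
  next
    case False
    then obtain u v where d: "u * b + v * (a mod b) dvd b" "u * b + v * (a mod b) dvd a mod b"
      using less.IH[of "a mod b" b] mod_size_less by blast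
    have "u * b + v * (a mod b) = v * a + (u - v * (a div b)) * b"
      by (simp add: minus_div_mult_eq_mod[symmetric] algebra_simps)
    with d have "v * a + (u - v * (a div b)) * b dvd b" "v * a + (u - v * (a div b)) * b dvd a mod b"
      by simp_all
    then show ?thesis
      using dvd_mod_imp_dvd by blast
  qed
qed

text \<open>The Bezout combination divides \<open>p\<close>, so it is a unit or a multiple of
  \<open>p\<close>; a multiple of \<open>p\<close> cannot divide \<open>a\<close>. Dividing by the
  unit gives 1.\<close>

lemma bezout_irreducible:
  fixes p a :: "'a::field poly"
  assumes "Factorial_Ring.irreducible p" "\<not> p dvd a"
  shows "\<exists>u v. u * a + v * p = 1"
proof -
  obtain u v where d: "u * a + v * p dvd a" "u * a + v * p dvd p"
    using poly_bezout by blast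
  have "\<not> p dvd u * a + v * p"
    using assms d dvd_trans by blast
  then have "u * a + v * p dvd 1"
    using assms(1) d(2) irreducibleD' by blast
  then obtain w where "1 = (u * a + v * p) * w"
    by (rule dvdE)
  then have "(u * w) * a + (v * w) * p = 1"
    by (simp add: algebra_simps)
  then show ?thesis
    by blast
qed

text \<open>Being coprime to each \<open>p i\<close>, the divisor \<open>e\<close> remains a divisor
  when the powers are cancelled one after another. It serves to find an irreducible factor
  \<open>p i\<close> in a divisor of the product that is not a unit.\<close>

lemma dvd_prod_irreducible_powers:
  fixes p :: "'i \<Rightarrow> 'a::field poly"
  assumes "finite I" "\<And>i. i \<in> I \<Longrightarrow> Factorial_Ring.irreducible (p i)"
    and "e dvd (\<Prod>i\<in>I. p i ^ l i)" "\<And>i. i \<in> I \<Longrightarrow> \<not> p i dvd e"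
  shows "e dvd 1"
  using assms
proof (induction I rule: finite_induct)
  case (insert i I)
  obtain u v where uv: "u * e + v * p i = 1"
    using bezout_irreducible insert.prems(1,3) by blast
  have cancel: "e dvd y" if "e dvd p i * y" for y
  proof -
    have "y = (u * e + v * p i) * y"
      by (simp add: uv)
    also have "\<dots> = e * (u * y) + v * (p i * y)"
      by (simp add: algebra_simps)
    finally have "y = e * (u * y) + v * (p i * y)" .
    with that show ?thesis
      by (metis dvd_add dvd_mult dvd_triv_left)
  qed
  have "e dvd y" if "e dvd p i ^ k * y" for k y
    using that by (induction k) (auto simp: mult.assoc dest: cancel)
  moreover have "e dvd p i ^ l i * (\<Prod>j\<in>I. p j ^ l j)"
    using insert.prems(2) unfolding prod.insert[OF insert.hyps] .
  ultimately have "e dvd (\<Prod>j\<in>I. p j ^ l j)" .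
  then show ?case
    using insert.IH insert.prems(1,3) by blast
qed simp

lemma monic_irreducible_dvd_eq:
  fixes p q :: "'a::field poly"
  assumes "Factorial_Ring.irreducible p" "Factorial_Ring.irreducible q"
    and "lead_coeff p = 1" "lead_coeff q = 1" "p dvd q"
  shows "p = q"
proof -
  have "q dvd p"
    using assms by (meson irreducibleD' irreducible_not_unit)
  then show ?thesis
    using assms by (metis poly_dvd_antisym)
qed

section \<open>Subrings and integrality\<close>

text \<open>Instantiated by the valuation ring inside the base field and by
  \<open>R[\<alpha>]\<close> inside the algebraic closure, so that the same rules apply to both
  rings.\<close>

locale subring_set =
  fixes S :: "'k::field set"
  assumes zero_closed: "0 \<in> S"
    and one_closed: "1 \<in> S"
    and add_closed: "x \<in> S \<Longrightarrow> y \<in> S \<Longrightarrow> x + y \<in> S"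
    and mult_closed: "x \<in> S \<Longrightarrow> y \<in> S \<Longrightarrow> x * y \<in> S"
    and uminus_closed: "x \<in> S \<Longrightarrow> - x \<in> S"
begin

lemma diff_closed: "x \<in> S \<Longrightarrow> y \<in> S \<Longrightarrow> x - y \<in> S"
  using add_closed[OF _ uminus_closed, of x y] by simp

lemma sum_closed: "(\<And>i. i \<in> I \<Longrightarrow> h i \<in> S) \<Longrightarrow> sum h I \<in> S"
  by (induction I rule: infinite_finite_induct) (auto simp: zero_closed add_closed)

lemma power_closed: "x \<in> S \<Longrightarrow> x ^ n \<in> S"
  by (induction n) (auto simp: one_closed mult_closed)

lemma coeff_closed: "p \<in> polys_over S \<Longrightarrow> poly.coeff p n \<in> S"
  by (simp add: polys_over_def)

lemma pCons_closed: "a \<in> S \<Longrightarrow> p \<in> polys_over S \<Longrightarrow> pCons a p \<in> polys_over S"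
  by (auto simp: polys_over_def coeff_pCons split: nat.splits)

lemma zero_poly_closed: "0 \<in> polys_over S"
  by (simp add: polys_over_def zero_closed)

lemma const_poly_closed: "a \<in> S \<Longrightarrow> [:a:] \<in> polys_over S"
  by (simp add: pCons_closed zero_poly_closed)

lemma one_poly_closed: "1 \<in> polys_over S"
  by (simp add: one_pCons const_poly_closed one_closed)

lemma add_poly_closed: "p \<in> polys_over S \<Longrightarrow> q \<in> polys_over S \<Longrightarrow> p + q \<in> polys_over S"
  by (simp add: polys_over_def add_closed)

lemma uminus_poly_closed: "p \<in> polys_over S \<Longrightarrow> - p \<in> polys_over S"
  by (simp add: polys_over_def uminus_closed)

lemma diff_poly_closed: "p \<in> polys_over S \<Longrightarrow> q \<in> polys_over S \<Longrightarrow> p - q \<in> polys_over S"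
  by (simp add: polys_over_def diff_closed)

lemma mult_poly_closed: "p \<in> polys_over S \<Longrightarrow> q \<in> polys_over S \<Longrightarrow> p * q \<in> polys_over S"
  by (simp add: polys_over_def coeff_mult sum_closed mult_closed)

lemma smult_poly_closed: "a \<in> S \<Longrightarrow> q \<in> polys_over S \<Longrightarrow> smult a q \<in> polys_over S"
  by (simp add: polys_over_def mult_closed)

lemma monom_poly_closed: "a \<in> S \<Longrightarrow> Polynomial.monom a n \<in> polys_over S"
  by (simp add: polys_over_def zero_closed)

lemma sum_poly_closed:
  "(\<And>i. i \<in> I \<Longrightarrow> h i \<in> polys_over S) \<Longrightarrow> sum h I \<in> polys_over S"
  by (induction I rule: infinite_finite_induct) (auto simp: zero_poly_closed add_poly_closed)

lemma prod_poly_closed: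
  "(\<And>i. i \<in> I \<Longrightarrow> h i \<in> polys_over S) \<Longrightarrow> prod h I \<in> polys_over S"
  by (induction I rule: infinite_finite_induct)
    (auto simp: mult_poly_closed one_poly_closed)

lemma power_poly_closed: "p \<in> polys_over S \<Longrightarrow> p ^ n \<in> polys_over S"
  by (induction n) (auto simp: mult_poly_closed one_poly_closed)

text \<open>Long division: cancelling the leading term of \<open>h\<close> never divides by a
  coefficient, because \<open>p\<close> is monic, so nothing leaves \<open>S\<close>.\<close>

lemma monic_division_exists:
  assumes "p \<in> polys_over S" "lead_coeff p = 1" "h \<in> polys_over S"
  shows "\<exists>q\<in>polys_over S. \<exists>r\<in>polys_over S.
    h = q * p + r \<and> (r = 0 \<or> Polynomial.degree r < Polynomial.degree p)"
  using assms(3)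
proof (induction "Polynomial.degree h" arbitrary: h rule: less_induct)
  case less
  let ?n = "Polynomial.degree h" and ?d = "Polynomial.degree p"
  consider "h = 0" | "?n < ?d" | "h \<noteq> 0" "?d \<le> ?n" "?n = 0" | "h \<noteq> 0" "?d \<le> ?n" "0 < ?n"
    by linarith
  then show ?case
  proof cases
    \<comment> \<open>In degree zero, cancelling the leading term cannot lower the degree, so the
      induction needs this separate case.\<close>
    case 3
    then have "p = 1"
      using assms(2) by (metis le_zero_eq monic_degree_0)
    then have "h = h * p + 0"
      by simp
    then show ?thesis
      using less.prems zero_poly_closed by blast
  next
    case 4
    define t where "t = Polynomial.monom (lead_coeff h) (?n - ?d)"
    have t: "t \<in> polys_over S"
      using less.prems by (simp add: t_def monom_poly_closed coeff_closed)
    have p0: "p \<noteq> 0"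
      using assms(2) by auto
    have deg: "Polynomial.degree (t * p) = ?n"
      using 4 p0 by (simp add: t_def degree_mult_eq degree_monom_eq monom_eq_0_iff)
    have lc: "poly.coeff (t * p) ?n = lead_coeff h"
      using lead_coeff_mult[of t p] assms(2) deg 4 by (simp add: t_def degree_monom_eq)
    have "Polynomial.degree (h - t * p) < ?n"
    proof (rule degree_lessI)
      show "h - t * p \<noteq> 0 \<or> 0 < ?n"
        using 4 by simp
      show "\<forall>k\<ge>?n. poly.coeff (h - t * p) k = 0"
        using deg lc by (auto simp: le_less coeff_eq_0)
    qed
    then obtain q r where qr: "q \<in> polys_over S" "r \<in> polys_over S" "h - t * p = q * p + r"
      "r = 0 \<or> Polynomial.degree r < ?d"
      using less.hyps[of "h - t * p"] less.prems t assms(1)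
      by (auto simp: diff_poly_closed mult_poly_closed)
    have "h = (q + t) * p + r"
      using qr(3) by (simp add: algebra_simps)
    then show ?thesis
      using qr t add_poly_closed by blast
  next
    case 1
    then have "h = 0 * p + 0"
      by simp
    then show ?thesis
      using zero_poly_closed by blast
  next
    case 2
    then have "h = 0 * p + h"
      by simp
    then show ?thesis
      using 2 less.prems zero_poly_closed by blast
  qed
qed

text \<open>Division with remainder over a field is unique, so \<open>div\<close> and
  \<open>mod\<close> agree with the quotient and remainder found over \<open>S\<close>.\<close>

lemma monic_div_mod_closed:
  assumes "p \<in> polys_over S" "lead_coeff p = 1" "h \<in> polys_over S"
  shows "h div p \<in> polys_over S" "h mod p \<in> polys_over S"
proof -
  obtain q r where qr: "q \<in> polys_over S" "r \<in> polys_over S" "h = q * p + r"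
      "r = 0 \<or> Polynomial.degree r < Polynomial.degree p"
    using monic_division_exists[OF assms] by blast
  have p0: "p \<noteq> 0"
    using assms(2) by auto
  have "r mod p = r"
    using qr(4) mod_poly_less by auto
  then have m: "h mod p = r"
    by (simp add: qr(3) add.commute)
  have "q * p = h div p * p"
    using qr(3) m div_mult_mod_eq[of h p] by (metis add_right_cancel)
  then have "h div p = q"
    using p0 by simp
  then show "h div p \<in> polys_over S" "h mod p \<in> polys_over S"
    using qr m by simp_all
qed

text \<open>The Leibniz expansion of the determinant uses only sums, products and signs of entries,
  and the entries of the characteristic matrix are polynomials over \<open>S\<close>.\<close>

lemma char_poly_closed:
  assumes "A \<in> carrier_mat n n" "\<And>i j. i < n \<Longrightarrow> j < n \<Longrightarrow> A $$ (i, j) \<in> S"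
  shows "char_poly A \<in> polys_over S"
proof -
  have entry: "char_poly_matrix A $$ (i, j) \<in> polys_over S" if "i < n" "j < n" for i j
    using assms that
    by (auto simp: char_poly_matrix_def intro!: pCons_closed zero_poly_closed zero_closed
      one_poly_closed one_closed uminus_closed diff_closed)
  have sign: "signof p * q \<in> polys_over S" if "q \<in> polys_over S" for q :: "'k poly" and p :: "nat \<Rightarrow> nat"
    using that by (cases p rule: sign_cases) (auto simp: uminus_poly_closed)
  have cm: "char_poly_matrix A \<in> carrier_mat n n"
    using assms by simp
  show ?thesis
    unfolding char_poly_def det_def'[OF cm]
    by (intro sum_poly_closed sign prod_poly_closed entry)
      (auto dest: permutes_in_image)
qed

text \<open>The determinant trick: a stable finite family makes \<open>x\<close> an eigenvalue of a matrix over \<open>S\<close>.\<close>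

lemma integral_over_if_stable:
  fixes b :: "'i \<Rightarrow> 'k alg_closure"
  assumes I: "finite I" "i0 \<in> I" "b i0 \<noteq> 0"
    and stable: "\<And>i. i \<in> I \<Longrightarrow>
      \<exists>c. (\<forall>j\<in>I. c j \<in> S) \<and> x * b i = (\<Sum>j\<in>I. to_ac (c j) * b j)"
  shows "integral_over S x"
proof -
  obtain c where c: "\<And>i j. i \<in> I \<Longrightarrow> j \<in> I \<Longrightarrow> c i j \<in> S"
    "\<And>i. i \<in> I \<Longrightarrow> x * b i = (\<Sum>j\<in>I. to_ac (c i j) * b j)"
    using stable by metis
  define N where "N = card I"
  obtain h where h: "bij_betw h {0..<N} I"
    unfolding N_def using ex_bij_betw_nat_finite[OF I(1)] by blast
  have hI: "h i \<in> I" if "i < N" for i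
    using h that by (auto simp: bij_betw_def)
  define A where "A = mat N N (\<lambda>(i, j). c (h i) (h j))"
  define v where "v = vec N (\<lambda>i. b (h i))"
  have A: "A \<in> carrier_mat N N"
    by (simp add: A_def)
  have Av: "map_mat to_ac A *\<^sub>v v = x \<cdot>\<^sub>v v"
  proof (rule eq_vecI)
    fix i assume "i < dim_vec (x \<cdot>\<^sub>v v)"
    then have i: "i < N"
      by (simp add: v_def)
    have "(map_mat to_ac A *\<^sub>v v) $ i = (\<Sum>j\<in>{0..<N}. to_ac (c (h i) (h j)) * b (h j))"
      using i by (auto simp: A_def v_def scalar_prod_def intro!: sum.cong)
    also have "\<dots> = (\<Sum>j\<in>I. to_ac (c (h i) j) * b j)"
      using h by (rule sum.reindex_bij_betw)
    also have "\<dots> = (x \<cdot>\<^sub>v v) $ i"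
      using c(2)[OF hI[OF i]] i by (simp add: v_def)
    finally show "(map_mat to_ac A *\<^sub>v v) $ i = (x \<cdot>\<^sub>v v) $ i" .
  qed (simp add: A_def v_def)
  obtain k where k: "k < N" "h k = i0"
    using h I(2) by (auto simp: bij_betw_def)
  \<comment> \<open>The distinguished member \<open>b i0\<close>, found at position
    \<open>k\<close>, keeps the candidate eigenvector nonzero.\<close>
  have "v \<noteq> 0\<^sub>v N"
  proof
    assume "v = 0\<^sub>v N"
    then have "v $ k = 0"
      using k by simp
    then show False
      using I(3) k by (simp add: v_def)
  qed
  then have "eigenvalue (map_mat to_ac A) x"
    using Av A unfolding eigenvalue_def eigenvector_def
    by (intro exI[of _ v]) (auto simp: v_def)
  then have "poly (char_poly (map_mat to_ac A)) x = 0"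
    using eigenvalue_root_char_poly[of "map_mat to_ac A" N x] A by simp
  then have "eval_ac (char_poly A) x = 0"
    using to_ac.base.char_poly_hom[OF A] by simp
  moreover have "char_poly A \<in> polys_over S"
    using A by (rule char_poly_closed) (auto simp: A_def intro!: c(1) hI)
  moreover have "lead_coeff (char_poly A) = 1"
    using degree_monic_char_poly[OF A] by simp
  ultimately show ?thesis
    unfolding integral_over_def by blast
qed

end

section \<open>Evaluation in the algebraic closure, and monic relations over a subring of it\<close>

lemma eval_ac_add: "eval_ac (p + q) x = eval_ac p x + eval_ac q x"
  by (simp add: to_ac.hom_add)

lemma eval_ac_mult: "eval_ac (p * q) x = eval_ac p x * eval_ac q x"
  by (simp add: to_ac.hom_mult)

lemma eval_ac_uminus: "eval_ac (- p) x = - eval_ac p x"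
  by (simp add: to_ac.hom_uminus)

lemma eval_ac_diff: "eval_ac (p - q) x = eval_ac p x - eval_ac q x"
  by (simp add: to_ac.hom_minus)

lemma eval_ac_smult: "eval_ac (smult a p) x = to_ac a * eval_ac p x"
  by (simp add: to_ac.base.map_poly_hom_smult)

lemma eval_ac_power: "eval_ac (p ^ n) x = eval_ac p x ^ n"
  by (simp add: to_ac.hom_power)

lemmas eval_ac_simps =
  eval_ac_add eval_ac_mult eval_ac_uminus eval_ac_diff eval_ac_smult eval_ac_power

lemma eval_ac_as_sum:
  assumes "Polynomial.degree h < n"
  shows "eval_ac h x = (\<Sum>j<n. to_ac (poly.coeff h j) * x ^ j)"
proof -
  have "eval_ac h x = (\<Sum>j\<le>Polynomial.degree h. to_ac (poly.coeff h j) * x ^ j)"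
    by (simp add: poly_altdef)
  also have "\<dots> = (\<Sum>j<n. to_ac (poly.coeff h j) * x ^ j)"
    using assms by (intro sum.mono_neutral_left) (auto simp: coeff_eq_0)
  finally show ?thesis .
qed

text \<open>In \<open>integral_over\<close> the coefficients lie in the base field; here they come
  from the field that contains \<open>x\<close>, as integrality over \<open>R[\<alpha>]\<close>
  demands. The value \<open>m = 0\<close> would mean \<open>1 = 0\<close>, so it admits
  nothing.\<close>

definition monic_relation :: "'a::field set \<Rightarrow> 'a \<Rightarrow> bool" where
  "monic_relation A x \<longleftrightarrow>
     (\<exists>m a. (\<forall>j<m. a j \<in> A) \<and> x ^ m = (\<Sum>j<m. a j * x ^ j))"

lemma monic_relationI:
  assumes "\<And>j. j < m \<Longrightarrow> a j \<in> A" "x ^ m = (\<Sum>j<m. a j * x ^ j)"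
  shows "monic_relation A x"
  unfolding monic_relation_def using assms by (intro exI[of _ m] exI[of _ a]) simp

context subring_set
begin

lemma eval_in_adjoin_ring: "h \<in> polys_over S \<Longrightarrow> eval_ac h \<alpha> \<in> adjoin_ring S \<alpha>"
  by (auto simp: adjoin_ring_def)

lemma to_ac_in_adjoin_ring: "c \<in> S \<Longrightarrow> to_ac c \<in> adjoin_ring S \<alpha>"
  using eval_in_adjoin_ring[OF smult_poly_closed[OF _ one_poly_closed], of c \<alpha>]
  unfolding eval_ac_smult by simp

lemma generator_in_adjoin_ring: "\<alpha> \<in> adjoin_ring S \<alpha>"
  using eval_in_adjoin_ring[of "[:0, 1:]"]
  by (simp add: pCons_closed zero_closed one_closed zero_poly_closed one_poly_closed)

lemma subring_set_adjoin_ring: "subring_set (adjoin_ring S \<alpha>)"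
proof
  show "0 \<in> adjoin_ring S \<alpha>" "1 \<in> adjoin_ring S \<alpha>"
    using to_ac_in_adjoin_ring[OF zero_closed] to_ac_in_adjoin_ring[OF one_closed] by simp_all
next
  fix x y assume "x \<in> adjoin_ring S \<alpha>" "y \<in> adjoin_ring S \<alpha>"
  then show "x + y \<in> adjoin_ring S \<alpha>" "x * y \<in> adjoin_ring S \<alpha>"
    unfolding adjoin_ring_def
    using add_poly_closed mult_poly_closed by (auto simp flip: eval_ac_add eval_ac_mult)
next
  fix x assume "x \<in> adjoin_ring S \<alpha>"
  then show "- x \<in> adjoin_ring S \<alpha>"
    unfolding adjoin_ring_def using uminus_poly_closed by (auto simp flip: eval_ac_uminus)
qed

text \<open>Multiplying the relation by \<open>w ^ m\<close> turns the coefficient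
  \<open>a j\<close> into \<open>a j * w ^ (m - j)\<close>.\<close>

lemma monic_relation_scale:
  assumes "monic_relation S x" "w \<in> S"
  shows "monic_relation S (w * x)"
proof -
  obtain m a where a: "\<And>j. j < m \<Longrightarrow> a j \<in> S" "x ^ m = (\<Sum>j<m. a j * x ^ j)"
    using assms(1) unfolding monic_relation_def by blast
  have "(w * x) ^ m = (\<Sum>j<m. w ^ m * (a j * x ^ j))"
    by (simp add: power_mult_distrib a(2) sum_distrib_left)
  also have "\<dots> = (\<Sum>j<m. (a j * w ^ (m - j)) * (w * x) ^ j)"
  proof (rule sum.cong[OF refl])
    fix j assume "j \<in> {..<m}"
    then have "w ^ m = w ^ (m - j) * w ^ j"
      by (simp flip: power_add)
    then show "w ^ m * (a j * x ^ j) = (a j * w ^ (m - j)) * (w * x) ^ j"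
      by (simp add: power_mult_distrib)
  qed
  finally show ?thesis
    by (rule monic_relationI[rotated]) (intro mult_closed power_closed a(1) assms(2))
qed

lemma integral_over_imp_monic_relation:
  assumes "integral_over S x"
  shows "monic_relation (adjoin_ring S \<alpha>) x"
proof -
  interpret A: subring_set "adjoin_ring S \<alpha>"
    by (rule subring_set_adjoin_ring)
  obtain p where p: "p \<in> polys_over S" "lead_coeff p = 1" "eval_ac p x = 0"
    using assms unfolding integral_over_def by blast
  define m where "m = Polynomial.degree p"
  have "0 = (\<Sum>j<Suc m. to_ac (poly.coeff p j) * x ^ j)"
    using p(3) eval_ac_as_sum[of p "Suc m" x] by (simp add: m_def)
  also have "\<dots> = (\<Sum>j<m. to_ac (poly.coeff p j) * x ^ j) + x ^ m"
    using p(2) by (simp add: m_def)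
  finally have "x ^ m = (\<Sum>j<m. - to_ac (poly.coeff p j) * x ^ j)"
    by (simp add: sum_negf eq_neg_iff_add_eq_0 add.commute)
  moreover have "- to_ac (poly.coeff p j) \<in> adjoin_ring S \<alpha>" for j
    using p(1) by (intro A.uminus_closed to_ac_in_adjoin_ring coeff_closed)
  ultimately show ?thesis
    by (intro monic_relationI[of m "\<lambda>j. - to_ac (poly.coeff p j)"])
qed

text \<open>Transitivity of integrality. The products \<open>x ^ e * \<alpha> ^ j\<close> with
  \<open>e < m\<close> and \<open>j < n\<close> span a finite module over \<open>S\<close> that
  multiplication by \<open>x\<close> preserves, so the determinant trick applies.\<close>

lemma monic_relation_imp_integral_over:
  assumes f: "f \<in> polys_over S" "lead_coeff f = 1" "eval_ac f \<alpha> = 0"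
    and x: "monic_relation (adjoin_ring S \<alpha>) x"
  shows "integral_over S x"
proof -
  interpret A: subring_set "adjoin_ring S \<alpha>"
    by (rule subring_set_adjoin_ring)
  define n where "n = Polynomial.degree f"
  have n: "0 < n"
  proof (rule ccontr)
    assume "\<not> 0 < n"
    then have "f = 1"
      using monic_degree_0[OF f(2)] by (simp add: n_def)
    then show False
      using f(3) by simp
  qed
  have f0: "f \<noteq> 0"
    using f(2) by auto
  obtain m a where a: "\<And>j. j < m \<Longrightarrow> a j \<in> adjoin_ring S \<alpha>" "x ^ m = (\<Sum>j<m. a j * x ^ j)"
    using x unfolding monic_relation_def by blast
  have m: "0 < m"
    using a(2) by (cases m) auto
  \<comment> \<open>Division by the monic \<open>f\<close> stays over \<open>S\<close> and gives
    each element a representative of degree below \<open>n\<close>.\<close>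
  have repr: "\<exists>c. (\<forall>j. c j \<in> S) \<and> y = (\<Sum>j<n. to_ac (c j) * \<alpha> ^ j)"
    if y: "y \<in> adjoin_ring S \<alpha>" for y
  proof -
    obtain h where h: "h \<in> polys_over S" "y = eval_ac h \<alpha>"
      using y unfolding adjoin_ring_def by blast
    have "y = eval_ac (h div f * f + h mod f) \<alpha>"
      using h(2) by simp
    then have "y = eval_ac (h mod f) \<alpha>"
      using f(3) by (simp only: eval_ac_simps) simp
    moreover have "Polynomial.degree (h mod f) < n"
      using degree_mod_less[OF f0, of h] n by (auto simp: n_def)
    ultimately have "y = (\<Sum>j<n. to_ac (poly.coeff (h mod f) j) * \<alpha> ^ j)"
      using eval_ac_as_sum by blast
    moreover have "poly.coeff (h mod f) j \<in> S" for j
      using monic_div_mod_closed(2)[OF f(1,2) h(1)] coeff_closed by blast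
    ultimately show ?thesis
      by (intro exI[of _ "poly.coeff (h mod f)"]) blast
  qed
  let ?I = "{..<m} \<times> {..<n}"
  define b where "b = (\<lambda>(e, j). x ^ e * \<alpha> ^ j)"
  have comb: "\<exists>c. (\<forall>i\<in>?I. c i \<in> S) \<and>
      (\<Sum>e<m. y e * x ^ e) = (\<Sum>i\<in>?I. to_ac (c i) * b i)"
    if y: "\<And>e. e < m \<Longrightarrow> y e \<in> adjoin_ring S \<alpha>" for y
  proof -
    have "\<forall>e\<in>{..<m}. \<exists>c. (\<forall>j. c j \<in> S) \<and> y e = (\<Sum>j<n. to_ac (c j) * \<alpha> ^ j)"
      using repr y by blast
    then obtain c where c: "\<And>e j. e < m \<Longrightarrow> c e j \<in> S"
      "\<And>e. e < m \<Longrightarrow> y e = (\<Sum>j<n. to_ac (c e j) * \<alpha> ^ j)"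
      unfolding bchoice_iff by blast
    have "(\<Sum>e<m. y e * x ^ e) = (\<Sum>e<m. \<Sum>j<n. to_ac (c e j) * b (e, j))"
      by (intro sum.cong refl) (simp add: c(2) b_def sum_distrib_left mult_ac)
    also have "\<dots> = (\<Sum>i\<in>?I. to_ac (case i of (e, j) \<Rightarrow> c e j) * b i)"
      by (simp add: sum.cartesian_product split_def)
    finally show ?thesis
      using c(1) by (intro exI[of _ "\<lambda>(e, j). c e j"]) auto
  qed
  show ?thesis
  proof (rule integral_over_if_stable[of ?I "(0, 0)" b])
    show "finite ?I" "(0, 0) \<in> ?I" "b (0, 0) \<noteq> 0"
      using m n by (auto simp: b_def)
  next
    fix i assume "i \<in> ?I"
    then obtain e j where i: "i = (e, j)" "e < m" "j < n"
      by auto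
    have \<alpha>j: "\<alpha> ^ j \<in> adjoin_ring S \<alpha>"
      by (intro A.power_closed generator_in_adjoin_ring)
    \<comment> \<open>Multiplication by \<open>x\<close> raises the exponent \<open>e\<close> by
      one; from the top exponent \<open>m - 1\<close> the monic relation leads back below
      \<open>m\<close>.\<close>
    have "\<exists>y. (\<forall>e'<m. y e' \<in> adjoin_ring S \<alpha>) \<and> x * b i = (\<Sum>e'<m. y e' * x ^ e')"
    proof (cases "Suc e < m")
      case True
      have "(\<Sum>e'<m. (if e' = Suc e then \<alpha> ^ j else 0) * x ^ e') =
          (\<Sum>e'<m. if Suc e = e' then \<alpha> ^ j * x ^ e' else 0)"
        by (intro sum.cong) auto
      then have "x * b i = (\<Sum>e'<m. (if e' = Suc e then \<alpha> ^ j else 0) * x ^ e')"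
        using True by (simp add: i b_def)
      then show ?thesis
        using \<alpha>j A.zero_closed by (intro exI[of _ "\<lambda>e'. if e' = Suc e then \<alpha> ^ j else 0"]) auto
    next
      case False
      then have "Suc e = m"
        using i(2) by simp
      then have "x * b i = \<alpha> ^ j * x ^ m"
        by (auto simp: i b_def)
      also have "\<dots> = (\<Sum>e'<m. (\<alpha> ^ j * a e') * x ^ e')"
        by (simp add: a(2) sum_distrib_left mult.assoc)
      finally show ?thesis
        using \<alpha>j a(1) A.mult_closed by (intro exI[of _ "\<lambda>e'. \<alpha> ^ j * a e'"]) blast
    qed
    then obtain y where y: "\<And>e'. e' < m \<Longrightarrow> y e' \<in> adjoin_ring S \<alpha>"
      "x * b i = (\<Sum>e'<m. y e' * x ^ e')"
      by blast
    show "\<exists>c. (\<forall>j\<in>?I. c j \<in> S) \<and> x * b i = (\<Sum>j\<in>?I. to_ac (c j) * b j)"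
      unfolding y(2) by (rule comb[OF y(1)])
  qed
qed

end

section \<open>Reduction modulo the maximal ideal\<close>

locale residue_valuation = valuation \<nu>
  for \<nu> :: "'k::field \<Rightarrow> 'g::linordered_ab_group_add extended" +
  fixes res :: "'k \<Rightarrow> 'r::field"
  assumes residue: "residue_map \<nu> res"
begin

abbreviation R :: "'k set" where "R \<equiv> valuation_ring \<nu>"
abbreviation M :: "'k set" where "M \<equiv> valuation_ideal \<nu>"

lemma val_finite: "x \<noteq> 0 \<Longrightarrow> \<exists>g. \<nu> x = Fin g"
  using val_not_Minf[of x] val_eq_Pinf_iff[of x] by (cases "\<nu> x") auto

lemma val_one: "\<nu> 1 = 0"
proof -
  obtain g where g: "\<nu> 1 = Fin g"
    using val_finite[of 1] by auto
  then have "Fin g = Fin (g + g)"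
    using val_mult[of 1 1] by simp
  then show ?thesis
    using g by (simp add: zero_extended_def)
qed

lemma val_uminus_one: "\<nu> (- 1) = 0"
proof -
  obtain g where g: "\<nu> (- 1) = Fin g"
    using val_finite[of "- 1"] by auto
  then have "Fin (g + g) = Fin 0"
    using val_mult[of "- 1" "- 1"] val_one by (simp add: zero_extended_def)
  then show ?thesis
    using g by (simp add: zero_extended_def)
qed

sublocale subring_set R
proof
  show "0 \<in> R" "1 \<in> R"
    using val_eq_Pinf_iff[of 0] val_one by (simp_all add: valuation_ring_def)
next
  fix x y assume xy: "x \<in> R" "y \<in> R"
  then show "x + y \<in> R"
    using val_add[of x y] by (auto simp: valuation_ring_def min_def split: if_splits)
  show "x * y \<in> R"
    using xy val_mult[of x y] add_mono[of 0 "\<nu> x" 0 "\<nu> y"] by (simp add: valuation_ring_def)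
next
  fix x assume "x \<in> R"
  then show "- x \<in> R"
    using val_mult[of "- 1" x] val_uminus_one by (simp add: valuation_ring_def)
qed

text \<open>The value of \<open>x\<close> is finite and can be cancelled. With its companion for
  \<open>M\<close>, this trades comparisons of values for membership of quotients.\<close>

lemma divide_in_R_iff:
  assumes "x \<noteq> 0"
  shows "y / x \<in> R \<longleftrightarrow> \<nu> x \<le> \<nu> y"
proof -
  obtain g where g: "\<nu> x = Fin g"
    using val_finite assms by blast
  have "\<nu> y = \<nu> (y / x) + Fin g"
    using val_mult[of "y / x" x] assms g by simp
  then show ?thesis
    using g val_not_Minf[of "y / x"]
    by (cases "\<nu> (y / x)") (auto simp: valuation_ring_def zero_extended_def)
qed

lemma divide_in_M_iff:
  assumes "x \<noteq> 0"
  shows "y / x \<in> M \<longleftrightarrow> \<nu> x < \<nu> y"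
proof -
  obtain g where g: "\<nu> x = Fin g"
    using val_finite assms by blast
  have "\<nu> y = \<nu> (y / x) + Fin g"
    using val_mult[of "y / x" x] assms g by simp
  then show ?thesis
    using g val_not_Minf[of "y / x"]
    by (cases "\<nu> (y / x)") (auto simp: valuation_ideal_def zero_extended_def)
qed

lemma M_subset_R: "x \<in> M \<Longrightarrow> x \<in> R"
  by (simp add: valuation_ring_def valuation_ideal_def)

lemma divide_in_M_if_not_in_R: "x \<noteq> 0 \<Longrightarrow> y \<noteq> 0 \<Longrightarrow> y / x \<notin> R \<Longrightarrow> x / y \<in> M"
  by (auto simp: divide_in_R_iff divide_in_M_iff)

lemma res_eq_0_iff: "x \<in> R \<Longrightarrow> res x = 0 \<longleftrightarrow> x \<in> M"
  using residue unfolding residue_map_def by blast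

lemma res_add: "x \<in> R \<Longrightarrow> y \<in> R \<Longrightarrow> res (x + y) = res x + res y"
  using residue unfolding residue_map_def by blast

lemma res_mult: "x \<in> R \<Longrightarrow> y \<in> R \<Longrightarrow> res (x * y) = res x * res y"
  using residue unfolding residue_map_def by blast

lemma res_one: "res 1 = 1"
  using residue unfolding residue_map_def by blast

lemma res_zero: "res 0 = 0"
  using res_add[OF zero_closed zero_closed] by (metis add.right_neutral add_left_cancel)

lemma res_surj: "\<exists>x\<in>R. res x = y"
proof -
  have "y \<in> res ` R"
    using residue unfolding residue_map_def by blast
  then show ?thesis
    by blast
qed

lemma res_uminus: "x \<in> R \<Longrightarrow> res (- x) = - res x"
  using res_add[of x "- x"] uminus_closed res_zero by (simp add: eq_neg_iff_add_eq_0 add.commute)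

lemma res_sum: "(\<And>i. i \<in> I \<Longrightarrow> h i \<in> R) \<Longrightarrow> res (sum h I) = (\<Sum>i\<in>I. res (h i))"
  by (induction I rule: infinite_finite_induct) (auto simp: res_zero res_add sum_closed)

lemma coeff_res: "poly.coeff (map_poly res p) n = res (poly.coeff p n)"
  by (simp add: coeff_map_poly res_zero)

lemma res_poly_add:
  "p \<in> polys_over R \<Longrightarrow> q \<in> polys_over R \<Longrightarrow> map_poly res (p + q) = map_poly res p + map_poly res q"
  by (rule poly_eqI) (simp add: coeff_res res_add coeff_closed)

lemma res_poly_uminus: "p \<in> polys_over R \<Longrightarrow> map_poly res (- p) = - map_poly res p"
  by (rule poly_eqI) (simp add: coeff_res res_uminus coeff_closed)

lemma res_poly_diff:
  "p \<in> polys_over R \<Longrightarrow> q \<in> polys_over R \<Longrightarrow> map_poly res (p - q) = map_poly res p - map_poly res q"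
  using res_poly_add[of p "- q"] res_poly_uminus[of q] uminus_poly_closed[of q] by simp

lemma res_poly_mult:
  "p \<in> polys_over R \<Longrightarrow> q \<in> polys_over R \<Longrightarrow> map_poly res (p * q) = map_poly res p * map_poly res q"
  by (rule poly_eqI) (simp add: coeff_res coeff_mult res_sum res_mult mult_closed coeff_closed)

lemma res_poly_power: "p \<in> polys_over R \<Longrightarrow> map_poly res (p ^ n) = map_poly res p ^ n"
  by (induction n) (simp_all add: res_poly_mult power_poly_closed res_one)

lemma res_poly_smult:
  "c \<in> R \<Longrightarrow> p \<in> polys_over R \<Longrightarrow> map_poly res (smult c p) = smult (res c) (map_poly res p)"
  by (rule poly_eqI) (simp add: coeff_res res_mult coeff_closed)

lemma res_poly_eq_0_iff:
  "p \<in> polys_over R \<Longrightarrow> map_poly res p = 0 \<longleftrightarrow> (\<forall>n. poly.coeff p n \<in> M)"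
  by (simp add: poly_eq_iff coeff_res res_eq_0_iff coeff_closed)

lemma degree_res_le: "Polynomial.degree (map_poly res p) \<le> Polynomial.degree p"
  by (rule degree_map_poly_le)

lemma degree_res_monic:
  assumes "lead_coeff p = 1"
  shows "Polynomial.degree (map_poly res p) = Polynomial.degree p"
proof (rule antisym[OF degree_res_le le_degree])
  show "poly.coeff (map_poly res p) (Polynomial.degree p) \<noteq> 0"
    using assms by (simp add: coeff_res res_one)
qed

lemma res_poly_surj: "\<exists>p\<in>polys_over R. map_poly res p = y"
proof -
  obtain h where h: "\<And>c. h c \<in> R" "\<And>c. res (h c) = c"
    using res_surj by metis
  \<comment> \<open>The chosen lift \<open>h 0\<close> may be a nonzero element of \<open>M\<close>;
    zero has to lift to zero for the result to be a polynomial with the expected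
    coefficients.\<close>
  define p where "p = map_poly (\<lambda>c. if c = 0 then 0 else h c) y"
  have "poly.coeff p n = (if poly.coeff y n = 0 then 0 else h (poly.coeff y n))" for n
    by (simp add: p_def coeff_map_poly)
  then have "p \<in> polys_over R" "map_poly res p = y"
    using h zero_closed by (auto simp: polys_over_def poly_eq_iff coeff_res res_zero)
  then show ?thesis
    by blast
qed

text \<open>Divide by a coefficient of least value: all quotients lie in \<open>R\<close>, and the
  chosen coefficient becomes 1, which survives reduction.\<close>

lemma primitive_multiple:
  fixes h :: "'k poly"
  assumes "h \<noteq> 0"
  obtains j where "poly.coeff h j \<noteq> 0" "smult (1 / poly.coeff h j) h \<in> polys_over R"
    "map_poly res (smult (1 / poly.coeff h j) h) \<noteq> 0"
proof -
  let ?J = "{..Polynomial.degree h}"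
  let ?m = "MIN j\<in>?J. \<nu> (poly.coeff h j)"
  have "?m \<in> (\<lambda>j. \<nu> (poly.coeff h j)) ` ?J"
    by (rule Min_in) auto
  then obtain j where j: "?m = \<nu> (poly.coeff h j)"
    by blast
  have "\<nu> (poly.coeff h j) \<le> \<nu> (poly.coeff h i)" if "i \<le> Polynomial.degree h" for i
    unfolding j[symmetric] using that by (intro Min_le) auto
  moreover have "\<nu> (poly.coeff h i) = Pinf" if "\<not> i \<le> Polynomial.degree h" for i
    using that val_eq_Pinf_iff[of 0] by (simp add: coeff_eq_0)
  ultimately have le: "\<nu> (poly.coeff h j) \<le> \<nu> (poly.coeff h i)" for i
    by (cases "i \<le> Polynomial.degree h") auto
  have nz: "poly.coeff h j \<noteq> 0"
    using le[of "Polynomial.degree h"] assms val_eq_Pinf_iff by (metis Pinf_le leading_coeff_0_iff)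
  have "smult (1 / poly.coeff h j) h \<in> polys_over R"
    using le divide_in_R_iff[OF nz] by (simp add: polys_over_def)
  moreover have "poly.coeff (map_poly res (smult (1 / poly.coeff h j) h)) j = 1"
    using nz by (simp add: coeff_res res_one)
  then have "map_poly res (smult (1 / poly.coeff h j) h) \<noteq> 0"
    by auto
  ultimately show ?thesis
    using nz that by blast
qed

text \<open>The reduced remainder is still divisible by the reduction of \<open>p\<close>, but its
  degree is smaller because a monic polynomial keeps its degree under reduction; hence it is
  zero.\<close>

lemma res_mod_monic:
  assumes "p \<in> polys_over R" "lead_coeff p = 1" "h \<in> polys_over R"
    and "map_poly res p dvd map_poly res h"
  shows "map_poly res (h mod p) = 0"
    and "map_poly res h = map_poly res p * map_poly res (h div p)"
proof -
  note closed = monic_div_mod_closed[OF assms(1-3)]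
  have h: "map_poly res h = map_poly res p * map_poly res (h div p) + map_poly res (h mod p)"
    using closed assms(1)
    by (simp flip: res_poly_mult res_poly_add add: mult_poly_closed)
  then have dvd: "map_poly res p dvd map_poly res (h mod p)"
    using assms(4) by (metis dvd_add_right_iff dvd_triv_left)
  show "map_poly res (h mod p) = 0"
  proof (rule ccontr)
    assume nz: "map_poly res (h mod p) \<noteq> 0"
    then have "h mod p \<noteq> 0"
      by auto
    then have "Polynomial.degree (h mod p) < Polynomial.degree p"
      using degree_mod_less[of p h] assms(2) by fastforce
    then have "Polynomial.degree (map_poly res (h mod p)) < Polynomial.degree (map_poly res p)"
      using degree_res_le[of "h mod p"] degree_res_monic[OF assms(2)] by simp
    then show False
      using dvd_imp_degree_le[OF dvd nz] by simp
  qed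
  then show "map_poly res h = map_poly res p * map_poly res (h div p)"
    using h by simp
qed

text \<open>A nonzero generator of the maximal ideal. Working with it replaces the least positive
  value by divisibility in \<open>R\<close>.\<close>

definition uniformizer :: "'k \<Rightarrow> bool" where
  "uniformizer \<pi> \<longleftrightarrow> \<pi> \<in> M \<and> \<pi> \<noteq> 0 \<and> (\<forall>x\<in>M. x / \<pi> \<in> R)"

lemma uniformizer_iff_least:
  assumes "x \<noteq> 0" "\<nu> x = Fin m"
  shows "uniformizer x \<longleftrightarrow> m \<in> pos_value_group \<nu> \<and> (\<forall>g\<in>pos_value_group \<nu>. m \<le> g)"
proof -
  have "(\<forall>y\<in>M. y / x \<in> R) \<longleftrightarrow> (\<forall>g\<in>pos_value_group \<nu>. m \<le> g)"
  proof
    assume *: "\<forall>y\<in>M. y / x \<in> R"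
    show "\<forall>g\<in>pos_value_group \<nu>. m \<le> g"
    proof
      fix g assume "g \<in> pos_value_group \<nu>"
      then obtain y where y: "y \<noteq> 0" "\<nu> y = Fin g" "0 < g"
        by (auto simp: pos_value_group_def value_group_def)
      then have "y / x \<in> R"
        using * by (simp add: valuation_ideal_def zero_extended_def)
      then show "m \<le> g"
        using divide_in_R_iff[OF assms(1)] assms(2) y(2) by simp
    qed
  next
    assume *: "\<forall>g\<in>pos_value_group \<nu>. m \<le> g"
    show "\<forall>y\<in>M. y / x \<in> R"
    proof
      fix y assume y: "y \<in> M"
      show "y / x \<in> R"
      proof (cases "y = 0")
        case True
        then show ?thesis by (simp add: zero_closed)
      next
        case False
        then obtain g where g: "\<nu> y = Fin g"
          using val_finite by blast
        then have "g \<in> pos_value_group \<nu>"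
          using False y
          by (auto simp: valuation_ideal_def pos_value_group_def value_group_def zero_extended_def)
        then show ?thesis
          using * g assms by (simp add: divide_in_R_iff)
      qed
    qed
  qed
  moreover have "x \<in> M \<longleftrightarrow> m \<in> pos_value_group \<nu>"
    using assms by (auto simp: valuation_ideal_def pos_value_group_def value_group_def zero_extended_def)
  ultimately show ?thesis
    using assms(1) by (auto simp: uniformizer_def)
qed

lemma ex_uniformizer_iff:
  "(\<exists>\<pi>. uniformizer \<pi>) \<longleftrightarrow> (\<exists>m\<in>pos_value_group \<nu>. \<forall>g\<in>pos_value_group \<nu>. m \<le> g)"
proof
  assume "\<exists>\<pi>. uniformizer \<pi>"
  then obtain \<pi> where \<pi>: "uniformizer \<pi>"
    by blast
  then obtain m where "\<nu> \<pi> = Fin m"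
    using val_finite uniformizer_def by blast
  then show "\<exists>m\<in>pos_value_group \<nu>. \<forall>g\<in>pos_value_group \<nu>. m \<le> g"
    using uniformizer_iff_least \<pi> uniformizer_def by blast
next
  assume "\<exists>m\<in>pos_value_group \<nu>. \<forall>g\<in>pos_value_group \<nu>. m \<le> g"
  then obtain m where m: "m \<in> pos_value_group \<nu>" "\<forall>g\<in>pos_value_group \<nu>. m \<le> g"
    by blast
  then obtain x where "x \<noteq> 0" "\<nu> x = Fin m"
    by (auto simp: pos_value_group_def value_group_def)
  then show "\<exists>\<pi>. uniformizer \<pi>"
    using uniformizer_iff_least m by blast
qed

lemma val_uniformizer:
  assumes "uniformizer \<pi>"
  shows "\<nu> \<pi> = Fin (LEAST g. g \<in> pos_value_group \<nu>)"
proof -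
  have nz: "\<pi> \<noteq> 0"
    using assms by (simp add: uniformizer_def)
  then obtain m where m: "\<nu> \<pi> = Fin m"
    using val_finite by blast
  then have "(LEAST g. g \<in> pos_value_group \<nu>) = m"
    using uniformizer_iff_least[OF nz m] assms by (intro Least_equality) auto
  then show ?thesis
    using m by simp
qed

lemma divide_uniformizer_closed:
  assumes "uniformizer \<pi>" "p \<in> polys_over R" "map_poly res p = 0"
  shows "smult (1 / \<pi>) p \<in> polys_over R"
  using assms by (simp add: res_poly_eq_0_iff polys_over_def uniformizer_def)

text \<open>All coefficients have value at least that of \<open>\<pi>\<close>. Equality of the
  minimum therefore means that some coefficient divided by \<open>\<pi>\<close> lies outside
  \<open>M\<close>.\<close>

lemma gauss_eq_val_uniformizer_iff:
  assumes \<pi>: "uniformizer \<pi>" and p: "p \<in> polys_over R" "map_poly res p = 0"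
  shows "gauss_extension \<nu> p = \<nu> \<pi> \<longleftrightarrow> map_poly res (smult (1 / \<pi>) p) \<noteq> 0"
proof -
  let ?v = "\<lambda>j. \<nu> (poly.coeff p j)" and ?J = "{..Polynomial.degree p}"
  have nz: "\<pi> \<noteq> 0"
    using \<pi> by (simp add: uniformizer_def)
  have le: "\<nu> \<pi> \<le> ?v j" for j
    using \<pi> p divide_in_R_iff[OF nz] by (simp add: uniformizer_def res_poly_eq_0_iff)
  have "gauss_extension \<nu> p = \<nu> \<pi> \<longleftrightarrow> \<nu> \<pi> \<in> ?v ` ?J"
    unfolding gauss_extension_def using le by (subst Min_eq_iff) auto
  also have "\<dots> \<longleftrightarrow> (\<exists>j. ?v j = \<nu> \<pi>)"
  proof -
    \<comment> \<open>Beyond the degree the value is \<open>Pinf\<close>, which differs from the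
      finite value of \<open>\<pi>\<close>, so \<open>j\<close> may range over all naturals.\<close>
    have J: "j \<in> ?J" if "?v j = \<nu> \<pi>" for j
    proof (rule ccontr)
      assume "j \<notin> ?J"
      then have "?v j = Pinf"
        by (simp add: coeff_eq_0 val_eq_Pinf_iff)
      then show False
        using that nz val_eq_Pinf_iff by simp
    qed
    show ?thesis
    proof
      assume "\<exists>j. ?v j = \<nu> \<pi>"
      then obtain j where "?v j = \<nu> \<pi>"
        by blast
      then show "\<nu> \<pi> \<in> ?v ` ?J"
        using J[of j] by (intro image_eqI[of _ _ j]) auto
    qed auto
  qed
  also have "\<dots> \<longleftrightarrow> \<not> (\<forall>j. poly.coeff p j / \<pi> \<in> M)"
    using le by (simp add: divide_in_M_iff[OF nz] less_le) metis
  also have "\<dots> \<longleftrightarrow> map_poly res (smult (1 / \<pi>) p) \<noteq> 0"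
    by (simp add: res_poly_eq_0_iff[OF divide_uniformizer_closed[OF \<pi> p]])
  finally show ?thesis .
qed

end

section \<open>The order generated by a root\<close>

text \<open>After multiplication by \<open>t ^ m\<close>, each term on the right keeps a factor
  \<open>t\<close> because \<open>j < m\<close>. It is used with \<open>t\<close> a constant of
  \<open>M\<close> and with \<open>t\<close> the value of some \<open>\<phi> i\<close> at
  \<open>\<alpha>\<close>.\<close>

lemma (in subring_set) monic_relation_clear_denominator:
  assumes "monic_relation S b" "t \<in> S" "t * b \<in> S"
  shows "\<exists>m. \<exists>y\<in>S. (t * b) ^ m = t * y"
proof -
  obtain m a where a: "\<And>j. j < m \<Longrightarrow> a j \<in> S" "b ^ m = (\<Sum>j<m. a j * b ^ j)"
    using assms(1) unfolding monic_relation_def by blast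
  have "(t * b) ^ m = (\<Sum>j<m. t ^ m * (a j * b ^ j))"
    by (simp add: power_mult_distrib a(2) sum_distrib_left)
  also have "\<dots> = (\<Sum>j<m. t * (a j * t ^ (m - Suc j) * (t * b) ^ j))"
  proof (rule sum.cong[OF refl])
    fix j assume "j \<in> {..<m}"
    then have "t ^ m = t ^ (Suc (m - Suc j) + j)"
      by simp
    then have "t ^ m = t * t ^ (m - Suc j) * t ^ j"
      unfolding power_add power_Suc .
    then show "t ^ m * (a j * b ^ j) = t * (a j * t ^ (m - Suc j) * (t * b) ^ j)"
      by (simp add: power_mult_distrib)
  qed
  also have "\<dots> = t * (\<Sum>j<m. a j * t ^ (m - Suc j) * (t * b) ^ j)"
    by (simp add: sum_distrib_left)
  finally have "(t * b) ^ m = t * (\<Sum>j<m. a j * t ^ (m - Suc j) * (t * b) ^ j)" .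
  moreover have "(\<Sum>j<m. a j * t ^ (m - Suc j) * (t * b) ^ j) \<in> S"
    using a(1) assms(2,3) by (intro sum_closed mult_closed[OF mult_closed] power_closed) auto
  ultimately show ?thesis
    by blast
qed

locale monic_root = residue_valuation \<nu> res
  for \<nu> :: "'k::field \<Rightarrow> 'g::linordered_ab_group_add extended" and res :: "'k \<Rightarrow> 'r::field" +
  fixes f :: "'k poly" and \<alpha> :: "'k alg_closure"
  assumes f_closed: "f \<in> polys_over R"
    and f_monic: "lead_coeff f = 1"
    and f_irreducible: "Factorial_Ring.irreducible f"
    and f_root: "eval_ac f \<alpha> = 0"
begin

abbreviation A :: "'k alg_closure set" where "A \<equiv> adjoin_ring R \<alpha>"
abbreviation L :: "'k alg_closure set" where "L \<equiv> adjoin_field \<alpha>"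
abbreviation red :: "'k poly \<Rightarrow> 'r poly" where "red \<equiv> map_poly res"

sublocale A: subring_set A
  by (rule subring_set_adjoin_ring)

lemma f_nonzero: "f \<noteq> 0"
  using f_monic by auto

text \<open>Otherwise a Bezout identity for \<open>h\<close> and \<open>f\<close>, evaluated at
  \<open>\<alpha>\<close>, would read \<open>0 = 1\<close>.\<close>

lemma f_dvd_if_root:
  assumes "eval_ac h \<alpha> = 0"
  shows "f dvd h"
proof (rule ccontr)
  assume "\<not> f dvd h"
  then obtain u v where uv: "u * h + v * f = 1"
    using bezout_irreducible[OF f_irreducible] by blast
  have "eval_ac (u * h + v * f) \<alpha> = 0"
    using assms f_root by (simp only: eval_ac_simps) simp
  then show False
    by (simp add: uv)
qed

text \<open>The quotient of \<open>h\<close> by the monic \<open>f\<close> again has coefficients in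
  \<open>R\<close>, so the factorization passes to the residue field.\<close>

lemma red_f_dvd_if_root:
  assumes "h \<in> polys_over R" "eval_ac h \<alpha> = 0"
  shows "red f dvd red h"
proof -
  have "h = f * (h div f)"
    using f_dvd_if_root[OF assms(2)] by simp
  then have "red h = red f * red (h div f)"
    using res_poly_mult[OF f_closed monic_div_mod_closed(1)[OF f_closed f_monic assms(1)]] by simp
  then show ?thesis
    by simp
qed

text \<open>Writing \<open>y\<close> as the value of \<open>h\<close>, the polynomial
  \<open>g - smult c h\<close> vanishes at \<open>\<alpha>\<close> and has the same reduction as
  \<open>g\<close>. In effect, \<open>R[\<alpha>]\<close> modulo \<open>M\<close> is the polynomial
  ring over the residue field modulo \<open>red f\<close>.\<close>

lemma red_f_dvd_if_in_ideal:
  assumes "g \<in> polys_over R" "c \<in> M" "y \<in> A" "eval_ac g \<alpha> = to_ac c * y"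
  shows "red f dvd red g"
proof -
  obtain h where h: "h \<in> polys_over R" "y = eval_ac h \<alpha>"
    using assms(3) unfolding adjoin_ring_def by blast
  have c: "c \<in> R" "res c = 0"
    using assms(2) M_subset_R res_eq_0_iff by auto
  have "eval_ac (g - smult c h) \<alpha> = 0"
    using assms(4) h(2) by (simp only: eval_ac_simps) simp
  then have "red f dvd red (g - smult c h)"
    using assms(1) c h by (intro red_f_dvd_if_root diff_poly_closed smult_poly_closed)
  also have "red (g - smult c h) = red g"
    using assms(1) c h by (simp add: res_poly_diff res_poly_smult smult_poly_closed)
  finally show ?thesis .
qed

lemma red_f_dvd_power:
  assumes "g \<in> polys_over R" "c \<in> M" "c \<noteq> 0" "monic_relation A (eval_ac g \<alpha> / to_ac c)"
  shows "\<exists>m. red f dvd red g ^ m"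
proof -
  have "to_ac c * (eval_ac g \<alpha> / to_ac c) = eval_ac g \<alpha>"
    using assms(3) by simp
  then obtain m y where y: "y \<in> A" "eval_ac g \<alpha> ^ m = to_ac c * y"
    using A.monic_relation_clear_denominator[OF assms(4) to_ac_in_adjoin_ring[OF M_subset_R[OF assms(2)]]]
      eval_in_adjoin_ring[OF assms(1)] by auto
  have "red f dvd red (g ^ m)"
    using assms(1,2) y by (intro red_f_dvd_if_in_ideal[of _ c y] power_poly_closed)
      (simp_all only: eval_ac_power)
  then show ?thesis
    using res_poly_power[OF assms(1)] by metis
qed

lemma eval_in_L: "eval_ac h \<alpha> \<in> L"
proof -
  have "eval_ac h \<alpha> \<in> F" if F: "is_subfield F" "range to_ac \<subseteq> F" "\<alpha> \<in> F" for F
  proof (induction h)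
    case (pCons a h)
    have "to_ac a \<in> F"
      using F by blast
    then show ?case
      using pCons F by (simp add: to_ac.base.map_poly_pCons_hom is_subfield_def)
  qed (use F in \<open>simp add: is_subfield_def\<close>)
  then show ?thesis
    unfolding adjoin_field_def by blast
qed

text \<open>The polynomial values already form a field: a Bezout identity with \<open>f\<close>
  supplies inverses.\<close>

lemma L_eq: "L = range (\<lambda>h. eval_ac h \<alpha>)"
proof
  show "range (\<lambda>h. eval_ac h \<alpha>) \<subseteq> L"
    using eval_in_L by blast
  let ?E = "range (\<lambda>h. eval_ac h \<alpha>)"
  have "inverse (eval_ac h \<alpha>) \<in> ?E" for h
  proof (cases "f dvd h")
    case True
    then obtain k where "h = f * k"
      by (rule dvdE)
    then have "eval_ac h \<alpha> = 0"
      using f_root by (simp only: eval_ac_mult) simp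
    \<comment> \<open>Here the convention \<open>inverse 0 = 0\<close> is used, which
      \<open>is_subfield\<close> also has to satisfy.\<close>
    then have "inverse (eval_ac h \<alpha>) = eval_ac 0 \<alpha>"
      by simp
    then show ?thesis
      by blast
  next
    case False
    then obtain u v where uv: "u * h + v * f = 1"
      using bezout_irreducible[OF f_irreducible] by blast
    have "eval_ac (u * h + v * f) \<alpha> = eval_ac u \<alpha> * eval_ac h \<alpha>"
      using f_root by (simp only: eval_ac_simps) simp
    then have "eval_ac u \<alpha> * eval_ac h \<alpha> = 1"
      by (simp add: uv)
    then have "inverse (eval_ac h \<alpha>) = eval_ac u \<alpha>"
      by (metis inverse_unique mult.commute)
    then show ?thesis
      by blast
  qed
  moreover have "0 \<in> ?E" "1 \<in> ?E"
    using rangeI[of "\<lambda>h. eval_ac h \<alpha>" 0] rangeI[of "\<lambda>h. eval_ac h \<alpha>" 1] by simp_all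
  ultimately have "is_subfield ?E"
    unfolding is_subfield_def by (auto simp flip: eval_ac_add eval_ac_mult eval_ac_uminus)
  moreover have "to_ac c \<in> ?E" for c
    using rangeI[of "\<lambda>h. eval_ac h \<alpha>" "smult c 1"] unfolding eval_ac_smult by simp
  moreover have "\<alpha> \<in> ?E"
    using rangeI[of "\<lambda>h. eval_ac h \<alpha>" "[:0, 1:]"] by simp
  ultimately show "L \<subseteq> ?E"
    unfolding adjoin_field_def by (intro Inter_lower) auto
qed

text \<open>Take the representative of degree below that of \<open>f\<close> and pull out a
  coefficient \<open>b\<close> of least value. Since \<open>x\<close> is not in \<open>A\<close>,
  \<open>b\<close> is not in \<open>R\<close>, so \<open>c = 1 / b\<close> is in \<open>M\<close>;
  the nonzero \<open>red g\<close> has too small a degree to be divisible by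
  \<open>red f\<close>.\<close>

lemma denominator_in_M:
  assumes "x \<in> L" "x \<notin> A"
  obtains g c where "g \<in> polys_over R" "c \<in> M" "c \<noteq> 0" "x = eval_ac g \<alpha> / to_ac c"
    "\<not> red f dvd red g"
proof -
  obtain h0 where "x = eval_ac h0 \<alpha>"
    using assms(1) L_eq by blast
  then have "x = eval_ac (h0 div f * f + h0 mod f) \<alpha>"
    by simp
  then have x: "x = eval_ac (h0 mod f) \<alpha>"
    using f_root by (simp only: eval_ac_simps) simp
  define h where "h = h0 mod f"
  have h0: "h \<noteq> 0"
    using x assms(2) A.zero_closed by (auto simp: h_def)
  then have deg: "Polynomial.degree h < Polynomial.degree f"
    using degree_mod_less[OF f_nonzero, of h0] by (simp add: h_def)
  obtain j where j: "poly.coeff h j \<noteq> 0" "smult (1 / poly.coeff h j) h \<in> polys_over R"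
    "red (smult (1 / poly.coeff h j) h) \<noteq> 0"
    using primitive_multiple[OF h0] .
  define b where "b = poly.coeff h j"
  define g where "g = smult (1 / b) h"
  have b: "b \<noteq> 0" and g: "g \<in> polys_over R" "red g \<noteq> 0"
    using j by (simp_all add: b_def g_def)
  have h_eq: "h = smult b g"
    using b by (simp add: g_def)
  have "b \<notin> R"
  proof
    assume "b \<in> R"
    then have "h \<in> polys_over R"
      unfolding h_eq using g(1) smult_poly_closed by blast
    then show False
      using x assms(2) eval_in_adjoin_ring by (simp add: h_def)
  qed
  then have c: "1 / b \<in> M"
    using divide_in_M_if_not_in_R[of 1 b] b by simp
  have "x = eval_ac (smult b g) \<alpha>"
    using x h_eq by (simp add: h_def)
  also have "\<dots> = eval_ac g \<alpha> / to_ac (1 / b)"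
    unfolding eval_ac_smult by simp
  finally have xg: "x = eval_ac g \<alpha> / to_ac (1 / b)" .
  have "\<not> red f dvd red g"
  proof
    assume "red f dvd red g"
    then have "Polynomial.degree (red f) \<le> Polynomial.degree (red g)"
      using dvd_imp_degree_le g(2) by blast
    moreover have "Polynomial.degree g = Polynomial.degree h"
      using b by (simp add: g_def)
    ultimately show False
      using deg degree_res_le[of g] degree_res_monic[OF f_monic] by simp
  qed
  then show ?thesis
    using that[OF g(1) c _ xg] b by simp
qed

lemma monic_relation_imp_in_closure:
  assumes "x \<in> L" "monic_relation A x"
  shows "x \<in> integral_closure_in R L"
  using assms monic_relation_imp_integral_over[OF f_closed f_monic f_root]
  by (simp add: integral_closure_in_def)

lemma A_subset_closure: "A \<subseteq> integral_closure_in R L"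
proof
  fix x assume x: "x \<in> A"
  then have "x \<in> L"
    using eval_in_L unfolding adjoin_ring_def by auto
  moreover have "monic_relation A x"
    by (rule monic_relationI[of 1 "\<lambda>_. x"]) (use x in auto)
  ultimately show "x \<in> integral_closure_in R L"
    by (rule monic_relation_imp_in_closure)
qed

end

section \<open>Dedekind's criterion\<close>

locale factored_reduction = monic_root \<nu> res f \<alpha>
  for \<nu> :: "'k::field \<Rightarrow> 'g::linordered_ab_group_add extended" and res :: "'k \<Rightarrow> 'r::field"
    and f :: "'k poly" and \<alpha> :: "'k alg_closure" +
  fixes s :: nat and \<phi>bar :: "nat \<Rightarrow> 'r poly" and l :: "nat \<Rightarrow> nat" and \<phi> :: "nat \<Rightarrow> 'k poly"
  assumes factorization: "red f = (\<Prod>i\<in>{1..s}. \<phi>bar i ^ l i)"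
    and \<phi>bar_inj: "inj_on \<phi>bar {1..s}"
    and \<phi>bar_monic: "i \<in> {1..s} \<Longrightarrow> lead_coeff (\<phi>bar i) = 1"
    and \<phi>bar_irreducible: "i \<in> {1..s} \<Longrightarrow> Factorial_Ring.irreducible (\<phi>bar i)"
    and l_pos: "i \<in> {1..s} \<Longrightarrow> 1 \<le> l i"
    and \<phi>_closed: "i \<in> {1..s} \<Longrightarrow> \<phi> i \<in> polys_over R"
    and \<phi>_monic: "i \<in> {1..s} \<Longrightarrow> lead_coeff (\<phi> i) = 1"
    and red_\<phi>: "i \<in> {1..s} \<Longrightarrow> red (\<phi> i) = \<phi>bar i"
begin

abbreviation q :: "nat \<Rightarrow> 'k poly" where "q i \<equiv> f div \<phi> i"
abbreviation r :: "nat \<Rightarrow> 'k poly" where "r i \<equiv> f mod \<phi> i"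

lemma red_f_split:
  assumes "i \<in> {1..s}"
  shows "red f = \<phi>bar i * (\<phi>bar i ^ (l i - 1) * (\<Prod>j\<in>{1..s} - {i}. \<phi>bar j ^ l j))"
proof -
  have "red f = \<phi>bar i ^ l i * (\<Prod>j\<in>{1..s} - {i}. \<phi>bar j ^ l j)"
    unfolding factorization using assms by (intro prod.remove) auto
  also have "\<phi>bar i ^ l i = \<phi>bar i * \<phi>bar i ^ (l i - 1)"
    using l_pos[OF assms] by (cases "l i") auto
  finally show ?thesis
    by (simp add: mult.assoc)
qed

lemma \<phi>bar_nonzero: "i \<in> {1..s} \<Longrightarrow> \<phi>bar i \<noteq> 0"
  using \<phi>bar_monic by fastforce

lemma \<phi>bar_dvd_power: "i \<in> {1..s} \<Longrightarrow> \<phi>bar i dvd p ^ m \<Longrightarrow> \<phi>bar i dvd p"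
  using field_poly_irreducible_imp_prime[OF \<phi>bar_irreducible] prime_elem_dvd_power by blast

lemma qr_closed:
  assumes "i \<in> {1..s}"
  shows "q i \<in> polys_over R" "r i \<in> polys_over R"
  using monic_div_mod_closed[OF \<phi>_closed[OF assms] \<phi>_monic[OF assms] f_closed] .

lemma red_qr:
  assumes "i \<in> {1..s}"
  shows "red (r i) = 0" "red f = \<phi>bar i * red (q i)"
proof -
  have "red (\<phi> i) dvd red f"
    unfolding red_\<phi>[OF assms] red_f_split[OF assms] by simp
  note res_mod_monic[OF \<phi>_closed[OF assms] \<phi>_monic[OF assms] f_closed this]
  then show "red (r i) = 0" "red f = \<phi>bar i * red (q i)"
    using red_\<phi>[OF assms] by simp_all
qed

text \<open>Cancelling one factor \<open>\<phi>bar i\<close> from \<open>red f\<close> leaves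
  \<open>red (q i)\<close> with that factor to the power \<open>l i - 1\<close>, and the other
  factors are distinct monic irreducibles.\<close>

lemma \<phi>bar_dvd_red_q_iff:
  assumes i: "i \<in> {1..s}"
  shows "\<phi>bar i dvd red (q i) \<longleftrightarrow> 2 \<le> l i"
proof -
  have q: "red (q i) = \<phi>bar i ^ (l i - 1) * (\<Prod>j\<in>{1..s} - {i}. \<phi>bar j ^ l j)"
    using red_qr(2)[OF i] red_f_split[OF i] \<phi>bar_nonzero[OF i] by simp
  show ?thesis
  proof
    assume dvd: "\<phi>bar i dvd red (q i)"
    show "2 \<le> l i"
    proof (rule ccontr)
      assume "\<not> 2 \<le> l i"
      then have "l i = 1"
        using l_pos[OF i] by simp
      then have "\<phi>bar i dvd (\<Prod>j\<in>{1..s} - {i}. \<phi>bar j ^ l j)"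
        using dvd q by simp
      moreover have "\<not> \<phi>bar i dvd 1"
        using \<phi>bar_irreducible[OF i] irreducible_not_unit by blast
      ultimately obtain j where j: "j \<in> {1..s} - {i}" "\<phi>bar j dvd \<phi>bar i"
        using dvd_prod_irreducible_powers[of "{1..s} - {i}" \<phi>bar "\<phi>bar i" l] \<phi>bar_irreducible
        by blast
      then have "\<phi>bar j = \<phi>bar i"
        using i by (intro monic_irreducible_dvd_eq \<phi>bar_irreducible \<phi>bar_monic) auto
      then show False
        using \<phi>bar_inj i j(1) by (auto dest: inj_onD)
    qed
  next
    assume "2 \<le> l i"
    then show "\<phi>bar i dvd red (q i)"
      unfolding q by (intro dvd_mult2 dvd_power) simp
  qed
qed

lemma relation_of_eval:
  assumes "i \<in> {1..s}"
  shows "eval_ac (\<phi> i) \<alpha> * eval_ac (q i) \<alpha> = - eval_ac (r i) \<alpha>"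
proof -
  have "eval_ac (\<phi> i * q i + r i) \<alpha> = 0"
    using f_root by simp
  then show ?thesis
    unfolding eval_ac_simps by (simp add: eq_neg_iff_add_eq_0)
qed

text \<open>Let \<open>D\<close> be the Bezout divisor of \<open>red f\<close> and
  \<open>red g\<close>, with cofactor \<open>E\<close> in \<open>red f\<close>. As \<open>E\<close>
  is not a unit, some \<open>\<phi>bar i\<close> divides it, and then \<open>red (q i)\<close> is a
  multiple of \<open>D\<close>, hence a multiple of \<open>red g\<close> modulo
  \<open>red f\<close>.\<close>

lemma non_closed_witness:
  assumes x: "x \<in> integral_closure_in R L" "x \<notin> A"
  obtains i g c where "i \<in> {1..s}" "2 \<le> l i" "g \<in> polys_over R" "c \<in> M" "c \<noteq> 0"
    "monic_relation A (eval_ac g \<alpha> / to_ac c)" "red f dvd red (q i) - red g"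
proof -
  have xL: "x \<in> L" and int: "monic_relation A x"
    using x integral_over_imp_monic_relation by (auto simp: integral_closure_in_def)
  obtain g c where g: "g \<in> polys_over R" "c \<in> M" "c \<noteq> 0" "x = eval_ac g \<alpha> / to_ac c"
    "\<not> red f dvd red g"
    using denominator_in_M[OF xL x(2)] .
  obtain u v where d: "u * red f + v * red g dvd red f" "u * red f + v * red g dvd red g"
    using poly_bezout by blast
  define D where "D = u * red f + v * red g"
  obtain E where E: "red f = D * E"
    using d(1) by (auto simp: D_def)
  have "\<not> E dvd 1"
  proof
    assume "E dvd 1"
    then have "red f dvd D"
      unfolding E by (simp add: mult_unit_dvd_iff)
    also have "D dvd red g"
      unfolding D_def by (rule d(2))
    finally show False
      using g(5) by blast
  qed
  then obtain i where i: "i \<in> {1..s}" "\<phi>bar i dvd E"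
    using dvd_prod_irreducible_powers[of "{1..s}" \<phi>bar E l] \<phi>bar_irreducible E factorization
    by (metis dvd_triv_right finite_atLeastAtMost)
  obtain E' where E': "E = \<phi>bar i * E'"
    using i(2) by (rule dvdE)
  have "\<phi>bar i * red (q i) = \<phi>bar i * (D * E')"
    unfolding red_qr(2)[OF i(1), symmetric] E E' by (simp add: mult_ac)
  then have q: "red (q i) = D * E'"
    using \<phi>bar_nonzero[OF i(1)] by simp
  \<comment> \<open>With this lift, \<open>w * g\<close> reduces to \<open>v * E' * red g\<close>,
    which differs from \<open>D * E'\<close> by \<open>u * E' * red f\<close>.\<close>
  obtain w where w: "w \<in> polys_over R" "red w = v * E'"
    using res_poly_surj by blast
  have red_wg: "red (w * g) = v * E' * red g"
    using res_poly_mult[OF w(1) g(1)] w(2) by simp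
  have diff: "red (q i) - red (w * g) = red f * (u * E')"
    unfolding q red_wg D_def by (simp add: algebra_simps)
  have wg: "w * g \<in> polys_over R"
    using w g mult_poly_closed by blast
  have "eval_ac (w * g) \<alpha> / to_ac c = eval_ac w \<alpha> * x"
    unfolding eval_ac_mult by (simp add: g(4))
  then have int': "monic_relation A (eval_ac (w * g) \<alpha> / to_ac c)"
    using A.monic_relation_scale[OF int eval_in_adjoin_ring[OF w(1)]] by simp
  \<comment> \<open>Integrality forces \<open>\<phi>bar i\<close> into \<open>red (w * g)\<close>
    and so into \<open>red (q i)\<close>, which yields the repeated factor.\<close>
  obtain m where "red f dvd red (w * g) ^ m"
    using red_f_dvd_power[OF wg g(2,3) int'] by blast
  then have "\<phi>bar i dvd red (w * g) ^ m"
    using red_qr(2)[OF i(1)] by (metis dvd_mult_left)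
  then have "\<phi>bar i dvd red (w * g)"
    using \<phi>bar_dvd_power[OF i(1)] by blast
  moreover have "\<phi>bar i dvd red (q i) - red (w * g)"
    unfolding diff unfolding red_qr(2)[OF i(1)] by (simp add: mult.assoc)
  ultimately have "\<phi>bar i dvd red (q i)"
    by (metis diff_add_cancel dvd_add)
  then show ?thesis
    using that[OF i(1) _ wg g(2,3) int'] \<phi>bar_dvd_red_q_iff[OF i(1)] diff by simp
qed

lemma closed_if_squarefree:
  assumes "\<forall>i\<in>{1..s}. l i = 1"
  shows "A = integral_closure_in R L"
proof (rule equalityI[OF A_subset_closure subsetI], rule ccontr)
  fix x assume "x \<in> integral_closure_in R L" "x \<notin> A"
  then obtain i where "i \<in> {1..s}" "2 \<le> l i"
    using non_closed_witness by blast
  then show False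
    using assms by auto
qed

lemma closed_if_uniformizer:
  assumes \<pi>: "uniformizer \<pi>"
    and r: "\<And>i. i \<in> {1..s} \<Longrightarrow> 2 \<le> l i \<Longrightarrow> red (smult (1 / \<pi>) (r i)) \<noteq> 0"
  shows "A = integral_closure_in R L"
proof (rule equalityI[OF A_subset_closure subsetI], rule ccontr)
  fix x assume "x \<in> integral_closure_in R L" "x \<notin> A"
  then obtain i g c where i: "i \<in> {1..s}" "2 \<le> l i" and g: "g \<in> polys_over R" "c \<in> M" "c \<noteq> 0"
    "monic_relation A (eval_ac g \<alpha> / to_ac c)" "red f dvd red (q i) - red g"
    using non_closed_witness by blast
  have \<pi>M: "\<pi> \<in> M" and \<pi>0: "\<pi> \<noteq> 0" and "c / \<pi> \<in> R"
    using \<pi> g(2) by (auto simp: uniformizer_def)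
  define b where "b = eval_ac g \<alpha> / to_ac \<pi>"
  \<comment> \<open>Since \<open>\<pi>\<close> divides \<open>c\<close>, changing the denominator to
    \<open>\<pi>\<close> only multiplies by an element of \<open>R\<close> and preserves the monic
    relation.\<close>
  have "b = to_ac (c / \<pi>) * (eval_ac g \<alpha> / to_ac c)"
    using g(3) by (simp add: b_def)
  then have b: "monic_relation A b"
    using A.monic_relation_scale[OF g(4) to_ac_in_adjoin_ring[OF \<open>c / \<pi> \<in> R\<close>]] by simp
  obtain k where k: "red (q i) - red g = red f * k"
    using g(5) by (rule dvdE)
  obtain u where u: "u \<in> polys_over R" "red u = k"
    using res_poly_surj by blast
  note cl = f_closed g(1) u(1) \<phi>_closed[OF i(1)] qr_closed[OF i(1)]
  define t where "t = smult (1 / \<pi>) (q i - g - f * u)"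
  define z where "z = smult (1 / \<pi>) (r i)"
  have "red (q i - g - f * u) = 0"
    using k u(2) cl by (simp add: res_poly_diff res_poly_mult diff_poly_closed mult_poly_closed)
  then have t: "t \<in> polys_over R"
    unfolding t_def using cl
    by (intro divide_uniformizer_closed[OF \<pi>] diff_poly_closed mult_poly_closed)
  have z: "z \<in> polys_over R"
    unfolding z_def using qr_closed red_qr i divide_uniformizer_closed[OF \<pi>] by blast
  have "smult \<pi> t = q i - g - f * u" "smult \<pi> z = r i"
    using \<pi>0 by (simp_all add: t_def z_def)
  then have "eval_ac (smult \<pi> t) \<alpha> = eval_ac (q i - g - f * u) \<alpha>"
    "eval_ac (smult \<pi> z) \<alpha> = eval_ac (r i) \<alpha>"
    by simp_all
  then have ev: "eval_ac g \<alpha> = eval_ac (q i) \<alpha> - to_ac \<pi> * eval_ac t \<alpha>"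
    "eval_ac (r i) \<alpha> = to_ac \<pi> * eval_ac z \<alpha>"
    unfolding eval_ac_simps f_root by simp_all
  \<comment> \<open>At \<open>\<alpha>\<close> the product of \<open>\<phi> i\<close> and
    \<open>q i\<close> is the negative of \<open>r i\<close>, that is, of \<open>\<pi>\<close> times
    \<open>z\<close>. Passing from \<open>q i\<close> to \<open>g\<close> contributes the term with
    \<open>t\<close>.\<close>
  define p where "p = - (z + \<phi> i * t)"
  have p: "p \<in> polys_over R"
    unfolding p_def using z t cl by (intro uminus_poly_closed add_poly_closed mult_poly_closed)
  have "eval_ac (\<phi> i) \<alpha> * b =
      (eval_ac (\<phi> i) \<alpha> * eval_ac (q i) \<alpha> - to_ac \<pi> * (eval_ac (\<phi> i) \<alpha> * eval_ac t \<alpha>)) / to_ac \<pi>"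
    by (simp add: b_def ev(1) algebra_simps)
  also have "\<dots> = eval_ac p \<alpha>"
    unfolding relation_of_eval[OF i(1)] p_def eval_ac_simps ev(2)
    using \<pi>0 by (simp add: field_simps)
  finally have \<phi>b: "eval_ac (\<phi> i) \<alpha> * b = eval_ac p \<alpha>" .
  \<comment> \<open>Denominators are now cleared with the value of \<open>\<phi> i\<close> instead
    of a constant; as \<open>\<phi>bar i\<close> divides \<open>red f\<close>, it will divide a
    power of \<open>red p\<close>.\<close>
  obtain m y where y: "y \<in> A" "eval_ac p \<alpha> ^ m = eval_ac (\<phi> i) \<alpha> * y"
    using A.monic_relation_clear_denominator[OF b eval_in_adjoin_ring[OF \<phi>_closed[OF i(1)]]]
      eval_in_adjoin_ring[OF p] \<phi>b by auto
  obtain h where h: "h \<in> polys_over R" "y = eval_ac h \<alpha>"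
    using y(1) unfolding adjoin_ring_def by blast
  have "eval_ac (p ^ m - \<phi> i * h) \<alpha> = 0"
    unfolding eval_ac_simps y(2) h(2) by simp
  then have "red f dvd red (p ^ m - \<phi> i * h)"
    using p h cl by (intro red_f_dvd_if_root diff_poly_closed mult_poly_closed power_poly_closed)
  also have "red (p ^ m - \<phi> i * h) = red p ^ m - \<phi>bar i * red h"
    using p h cl red_\<phi>[OF i(1)]
    by (simp add: res_poly_diff res_poly_mult res_poly_power power_poly_closed mult_poly_closed)
  finally have "\<phi>bar i dvd red p ^ m - \<phi>bar i * red h"
    using red_qr(2)[OF i(1)] by (metis dvd_mult_left)
  then have "\<phi>bar i dvd red p ^ m"
    by (metis diff_add_cancel dvd_add dvd_triv_left)
  then have "\<phi>bar i dvd red p"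
    using \<phi>bar_dvd_power[OF i(1)] by blast
  moreover have "red p = - (red z + \<phi>bar i * red t)"
    unfolding p_def using z t cl red_\<phi>[OF i(1)]
    by (simp add: res_poly_uminus res_poly_diff res_poly_mult uminus_poly_closed mult_poly_closed)
  ultimately have "\<phi>bar i dvd red z + \<phi>bar i * red t"
    by (metis dvd_minus_iff)
  then have dvd: "\<phi>bar i dvd red z"
    by (simp add: dvd_add_left_iff)
  have z0: "red z \<noteq> 0"
    using r i by (simp add: z_def)
  then have "r i \<noteq> 0"
    by (auto simp: z_def)
  then have "Polynomial.degree (r i) < Polynomial.degree (\<phi> i)"
    using degree_mod_less[of "\<phi> i" f] \<phi>_monic[OF i(1)] by fastforce
  moreover have "Polynomial.degree (\<phi> i) = Polynomial.degree (\<phi>bar i)"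
    using degree_res_monic[OF \<phi>_monic[OF i(1)]] red_\<phi>[OF i(1)] by simp
  moreover have "Polynomial.degree (red z) \<le> Polynomial.degree (r i)"
    using degree_res_le[of z] \<pi>0 by (simp add: z_def)
  ultimately show False
    using dvd_imp_degree_le[OF dvd z0] by simp
qed

text \<open>The value of \<open>q i\<close> divided by \<open>c\<close> satisfies a quadratic
  relation over \<open>A\<close>. If it were in \<open>A\<close>, then \<open>red f\<close> would
  divide its own proper factor \<open>red (q i)\<close>.\<close>

lemma not_closed_if_small:
  assumes i: "i \<in> {1..s}" "2 \<le> l i" and c: "c \<in> M" "c \<noteq> 0"
    and r2: "smult (1 / c\<^sup>2) (r i) \<in> polys_over R"
    and r1: "smult (1 / c) (q i mod \<phi> i) \<in> polys_over R"
  shows "A \<noteq> integral_closure_in R L"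
proof
  assume closed: "A = integral_closure_in R L"
  note cl = \<phi>_closed[OF i(1)] qr_closed[OF i(1)]
  let ?e = "\<lambda>h. eval_ac h \<alpha>"
  define q1 where "q1 = q i div \<phi> i"
  define z1 where "z1 = smult (1 / c) (q i mod \<phi> i)"
  define z where "z = smult (1 / c\<^sup>2) (r i)"
  have q1: "q1 \<in> polys_over R"
    unfolding q1_def using monic_div_mod_closed(1)[OF cl(1) \<phi>_monic[OF i(1)] cl(2)] .
  have z1: "z1 \<in> polys_over R" and z: "z \<in> polys_over R"
    using r1 r2 by (simp_all add: z1_def z_def)
  have "q i = \<phi> i * q1 + smult c z1" "r i = smult (c\<^sup>2) z"
    using c(2) by (simp_all add: q1_def z1_def z_def)
  then have "?e (q i) = ?e (\<phi> i * q1 + smult c z1)" "?e (r i) = ?e (smult (c\<^sup>2) z)"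
    by simp_all
  then have ev: "?e (q i) = ?e (\<phi> i) * ?e q1 + to_ac c * ?e z1" "?e (r i) = (to_ac c)\<^sup>2 * ?e z"
    unfolding eval_ac_simps by simp_all
  define b where "b = ?e (q i) / to_ac c"
  have qb: "?e (q i) = to_ac c * b"
    using c(2) by (simp add: b_def)
  have "(to_ac c)\<^sup>2 * b\<^sup>2 = ?e (q i) * ?e (q i)"
    by (simp add: qb power2_eq_square)
  also have "\<dots> = (?e (\<phi> i) * ?e (q i)) * ?e q1 + to_ac c * ?e z1 * ?e (q i)"
    by (subst ev(1)) (simp add: algebra_simps)
  also have "\<dots> = (to_ac c)\<^sup>2 * (?e z1 * b - ?e z * ?e q1)"
    unfolding relation_of_eval[OF i(1)] ev(2)
    unfolding qb by (simp add: algebra_simps power2_eq_square)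
  finally have "b\<^sup>2 = ?e z1 * b - ?e z * ?e q1"
    using c(2) by simp
  \<comment> \<open>The same equation in the shape of \<open>monic_relation\<close>, with
    \<open>m = 2\<close>.\<close>
  then have rel: "b ^ 2 = (\<Sum>j<2. (if j = 0 then - (?e z * ?e q1) else ?e z1) * b ^ j)"
    by (simp add: numeral_2_eq_2)
  have "monic_relation A b"
    by (rule monic_relationI[OF _ rel])
      (auto intro!: A.uminus_closed A.mult_closed eval_in_adjoin_ring z z1 q1)
  moreover have "b = ?e (smult (1 / c) (q i))"
    unfolding eval_ac_smult by (simp add: b_def)
  then have "b \<in> L"
    using eval_in_L by simp
  ultimately have "b \<in> A"
    using closed monic_relation_imp_in_closure by simp
  then have dvd: "red f dvd red (q i)"
    using red_f_dvd_if_in_ideal[OF cl(2) c(1) _ qb] by blast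
  have f0: "red f \<noteq> 0"
    using f_monic res_one coeff_res by (metis coeff_0 zero_neq_one)
  obtain k where "red (q i) = red f * k"
    using dvd by (rule dvdE)
  then have "red f * 1 = red f * (\<phi>bar i * k)"
    using red_qr(2)[OF i(1)] by (simp add: mult_ac)
  then have "\<phi>bar i * k = 1"
    using f0 by (metis mult_cancel_left)
  then have "\<phi>bar i dvd 1"
    by (metis dvd_triv_left)
  then show False
    using \<phi>bar_irreducible[OF i(1)] irreducible_not_unit by blast
qed

text \<open>Otherwise \<open>f\<close> would factor as \<open>\<phi> i * q i\<close>. Both factors
  have positive degree, the second because \<open>\<phi>bar i\<close> divides its nonzero
  reduction.\<close>

lemma r_nonzero:
  assumes i: "i \<in> {1..s}" "2 \<le> l i"
  shows "r i \<noteq> 0"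
proof
  assume "r i = 0"
  then have f: "f = \<phi> i * q i"
    by (metis add.right_neutral mult_div_mod_eq)
  have "\<not> \<phi>bar i dvd 1"
    using \<phi>bar_irreducible[OF i(1)] irreducible_not_unit by blast
  then have deg: "0 < Polynomial.degree (\<phi>bar i)"
    using \<phi>bar_nonzero[OF i(1)] is_unit_iff_degree by blast
  then have "0 < Polynomial.degree (\<phi> i)"
    using degree_res_le[of "\<phi> i"] red_\<phi>[OF i(1)] by simp
  moreover have "0 < Polynomial.degree (q i)"
  proof -
    have "red (q i) \<noteq> 0"
      using red_qr(2)[OF i(1)] f_monic res_one coeff_res
      by (metis coeff_0 mult_zero_right zero_neq_one)
    then have "Polynomial.degree (\<phi>bar i) \<le> Polynomial.degree (red (q i))"
      using \<phi>bar_dvd_red_q_iff[OF i(1)] i(2) dvd_imp_degree_le by blast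
    then show ?thesis
      using deg degree_res_le[of "q i"] by simp
  qed
  ultimately show False
    using f_irreducible f by (metis irreducibleD is_unit_iff_degree f_nonzero mult_eq_0_iff
        less_numeral_extra(3))
qed

text \<open>Without a uniformizer, every nonzero element of \<open>M\<close> is a product of two
  elements of \<open>M\<close>, and the square of the one with smaller value divides it. This
  supplies the constant for \<open>not_closed_if_small\<close>.\<close>

lemma uniformizer_if_closed:
  assumes closed: "A = integral_closure_in R L" and i: "i \<in> {1..s}" "2 \<le> l i"
  shows "\<exists>\<pi>. uniformizer \<pi>"
proof (rule ccontr)
  assume "\<nexists>\<pi>. uniformizer \<pi>"
  then have smaller: "\<exists>y\<in>M. y \<noteq> 0 \<and> x / y \<in> M" if x: "x \<in> M" "x \<noteq> 0" for x
  proof -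
    have "\<not> uniformizer x"
      using \<open>\<nexists>\<pi>. uniformizer \<pi>\<close> by blast
    then obtain y where y: "y \<in> M" "y / x \<notin> R"
      using x unfolding uniformizer_def by blast
    then have "y \<noteq> 0"
      using zero_closed by auto
    then show ?thesis
      using divide_in_M_if_not_in_R[OF x(2) _ y(2)] y(1) by blast
  qed
  obtain j where j: "poly.coeff (r i) j \<noteq> 0" "smult (1 / poly.coeff (r i) j) (r i) \<in> polys_over R"
    using primitive_multiple[OF r_nonzero[OF i]] by blast
  define a where "a = poly.coeff (r i) j"
  have a: "a \<in> M" "a \<noteq> 0"
    using j red_qr(1)[OF i(1)] qr_closed(2)[OF i(1)] by (auto simp: a_def res_poly_eq_0_iff)
  obtain y where y: "y \<in> M" "y \<noteq> 0" "a / y \<in> M"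
    using smaller[OF a] by blast
  \<comment> \<open>Of the factors \<open>y\<close> and \<open>a / y\<close>, the one with smaller
    value serves.\<close>
  have "\<exists>c\<in>M. c \<noteq> 0 \<and> a / c\<^sup>2 \<in> R"
  proof (cases "a / y\<^sup>2 \<in> R")
    case True
    then show ?thesis
      using y by blast
  next
    case False
    then have "y\<^sup>2 / a \<in> R"
      using divide_in_M_if_not_in_R[of "y\<^sup>2" a] y(2) a(2) M_subset_R by simp
    also have "y\<^sup>2 / a = a / (a / y)\<^sup>2"
      using y(2) a(2) by (simp add: field_simps power2_eq_square)
    finally show ?thesis
      using y a by (intro bexI[of _ "a / y"]) auto
  qed
  then obtain c where c: "c \<in> M" "c \<noteq> 0" "a / c\<^sup>2 \<in> R"
    by blast
  let ?r1 = "q i mod \<phi> i"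
  note cl = \<phi>_closed[OF i(1)] qr_closed[OF i(1)]
  have r1: "?r1 \<in> polys_over R"
    using monic_div_mod_closed(2)[OF cl(1) \<phi>_monic[OF i(1)] cl(2)] .
  have "red (\<phi> i) dvd red (q i)"
    using \<phi>bar_dvd_red_q_iff[OF i(1)] i red_\<phi> by simp
  then have red_r1: "red ?r1 = 0"
    using res_mod_monic(1)[OF cl(1) \<phi>_monic[OF i(1)] cl(2)] by blast
  \<comment> \<open>To divide \<open>?r1\<close> as well, take whichever of \<open>c\<close> and its
    least-valued coefficient \<open>b\<close> has smaller value; lowering the value preserves the
    condition on \<open>a\<close>.\<close>
  have "\<exists>d\<in>M. d \<noteq> 0 \<and> a / d\<^sup>2 \<in> R \<and> smult (1 / d) ?r1 \<in> polys_over R"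
  proof (cases "?r1 = 0")
    case True
    then show ?thesis
      using c zero_poly_closed by auto
  next
    case False
    then obtain k where k: "poly.coeff ?r1 k \<noteq> 0" "smult (1 / poly.coeff ?r1 k) ?r1 \<in> polys_over R"
      using primitive_multiple by blast
    define b where "b = poly.coeff ?r1 k"
    have b: "b \<in> M" "b \<noteq> 0" "smult (1 / b) ?r1 \<in> polys_over R"
      using k red_r1 r1 by (auto simp: b_def res_poly_eq_0_iff)
    show ?thesis
    proof (cases "b / c \<in> R")
      case True
      have "smult (1 / c) ?r1 = smult (b / c) (smult (1 / b) ?r1)"
        using b(2) by simp
      then have "smult (1 / c) ?r1 \<in> polys_over R"
        using True b(3) smult_poly_closed by metis
      then show ?thesis
        using c by blast
    next
      case False
      then have "c / b \<in> R"
        using divide_in_M_if_not_in_R[of c b] c b M_subset_R by blast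
      then have "(a / c\<^sup>2) * (c / b)\<^sup>2 \<in> R"
        using c by (intro mult_closed power_closed)
      also have "(a / c\<^sup>2) * (c / b)\<^sup>2 = a / b\<^sup>2"
        using c(2) by (simp add: field_simps)
      finally show ?thesis
        using b by blast
    qed
  qed
  then obtain d where d: "d \<in> M" "d \<noteq> 0" "a / d\<^sup>2 \<in> R" "smult (1 / d) ?r1 \<in> polys_over R"
    by blast
  have "smult (1 / d\<^sup>2) (r i) = smult (a / d\<^sup>2) (smult (1 / a) (r i))"
    using a(2) by simp
  then have "smult (1 / d\<^sup>2) (r i) \<in> polys_over R"
    using j(2) d(3) smult_poly_closed unfolding a_def by metis
  then show False
    using not_closed_if_small[OF i d(1,2) _ d(4)] closed by blast
qed

text \<open>If the quotient reduced to zero, \<open>r i\<close> could be divided by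
  \<open>\<pi>\<close> twice, while \<open>q i mod \<phi> i\<close> can be divided once; then
  \<open>not_closed_if_small\<close> applies with \<open>c = \<pi>\<close>.\<close>

lemma red_r_if_closed:
  assumes closed: "A = integral_closure_in R L" and i: "i \<in> {1..s}" "2 \<le> l i"
    and \<pi>: "uniformizer \<pi>"
  shows "red (smult (1 / \<pi>) (r i)) \<noteq> 0"
proof
  assume 0: "red (smult (1 / \<pi>) (r i)) = 0"
  note cl = \<phi>_closed[OF i(1)] qr_closed[OF i(1)]
  have "smult (1 / \<pi>) (r i) \<in> polys_over R"
    using divide_uniformizer_closed[OF \<pi> cl(3) red_qr(1)[OF i(1)]] .
  then have "smult (1 / \<pi>) (smult (1 / \<pi>) (r i)) \<in> polys_over R"
    using divide_uniformizer_closed[OF \<pi>] 0 by blast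
  then have r2: "smult (1 / \<pi>\<^sup>2) (r i) \<in> polys_over R"
    by (simp add: power2_eq_square)
  have "red (\<phi> i) dvd red (q i)"
    using \<phi>bar_dvd_red_q_iff[OF i(1)] i red_\<phi> by simp
  then have "smult (1 / \<pi>) (q i mod \<phi> i) \<in> polys_over R"
    using res_mod_monic(1)[OF cl(1) \<phi>_monic[OF i(1)] cl(2)]
      monic_div_mod_closed(2)[OF cl(1) \<phi>_monic[OF i(1)] cl(2)]
    by (intro divide_uniformizer_closed[OF \<pi>]) blast+
  then show False
    using not_closed_if_small[OF i _ _ r2] \<pi> closed by (auto simp: uniformizer_def)
qed

lemma closed_iff:
  assumes "{i\<in>{1..s}. 2 \<le> l i} \<noteq> {}"
  shows "A = integral_closure_in R L \<longleftrightarrow>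
    (\<exists>m\<in>pos_value_group \<nu>. \<forall>g\<in>pos_value_group \<nu>. m \<le> g) \<and>
    (\<forall>i\<in>{i\<in>{1..s}. 2 \<le> l i}.
       gauss_extension \<nu> (r i) = Fin (LEAST g. g \<in> pos_value_group \<nu>))"
  (is "?closed \<longleftrightarrow> ?min \<and> ?vals")
proof -
  \<comment> \<open>The \<open>LEAST\<close> term is known to be a minimum only once a uniformizer
    is given, so the translation is made relative to one.\<close>
  have vals: "?vals \<longleftrightarrow> (\<forall>i\<in>{i\<in>{1..s}. 2 \<le> l i}. red (smult (1 / \<pi>) (r i)) \<noteq> 0)"
    if "uniformizer \<pi>" for \<pi>
    using gauss_eq_val_uniformizer_iff[OF that] qr_closed(2) red_qr(1) val_uniformizer[OF that] by auto
  show ?thesis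
  proof
    assume ?closed
    obtain \<pi> where \<pi>: "uniformizer \<pi>"
      using uniformizer_if_closed[OF \<open>?closed\<close>] assms by blast
    then show "?min \<and> ?vals"
      using vals[OF \<pi>] red_r_if_closed[OF \<open>?closed\<close> _ _ \<pi>] ex_uniformizer_iff by blast
  next
    assume R: "?min \<and> ?vals"
    then obtain \<pi> where \<pi>: "uniformizer \<pi>"
      using ex_uniformizer_iff by blast
    then show ?closed
      using closed_if_uniformizer[OF \<pi>] vals[OF \<pi>] R by blast
  qed
qed

end

theorem theorem2p5:
  fixes \<nu> :: "'k::field \<Rightarrow> 'g::linordered_ab_group_add extended"
    and res :: "'k \<Rightarrow> 'r::field"
    and f :: "'k poly"
    and \<alpha> :: "'k alg_closure"
    and s :: nat
    and \<phi>bar :: "nat \<Rightarrow> 'r poly"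
    and l :: "nat \<Rightarrow> nat"
    and \<phi> r :: "nat \<Rightarrow> 'k poly"
  assumes "valuation \<nu>"
    and "residue_map \<nu> res"
    and "f \<in> polys_over (valuation_ring \<nu>)"
    and "lead_coeff f = 1"
    and "Factorial_Ring.irreducible f"
    and "separable_poly f"
    and "eval_ac f \<alpha> = 0"
    and "map_poly res f = (\<Prod>i\<in>{1..s}. \<phi>bar i ^ l i)"
    and "inj_on \<phi>bar {1..s}"
    and "\<And>i. i \<in> {1..s} \<Longrightarrow> lead_coeff (\<phi>bar i) = 1"
    and "\<And>i. i \<in> {1..s} \<Longrightarrow> Factorial_Ring.irreducible (\<phi>bar i)"
    and "\<And>i. i \<in> {1..s} \<Longrightarrow> 1 \<le> l i"
    and "\<And>i. i \<in> {1..s} \<Longrightarrow> \<phi> i \<in> polys_over (valuation_ring \<nu>)"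
    and "\<And>i. i \<in> {1..s} \<Longrightarrow> lead_coeff (\<phi> i) = 1"
    and "\<And>i. i \<in> {1..s} \<Longrightarrow> map_poly res (\<phi> i) = \<phi>bar i"
    and "\<And>i. i \<in> {1..s} \<Longrightarrow> r i = f mod \<phi> i"
  shows "((\<forall>i\<in>{1..s}. l i = 1) \<longrightarrow>
           adjoin_ring (valuation_ring \<nu>) \<alpha> =
             integral_closure_in (valuation_ring \<nu>) (adjoin_field \<alpha>)) \<and>
         ({i\<in>{1..s}. 2 \<le> l i} \<noteq> {} \<longrightarrow>
           (adjoin_ring (valuation_ring \<nu>) \<alpha> =
              integral_closure_in (valuation_ring \<nu>) (adjoin_field \<alpha>) \<longleftrightarrow>
            (\<exists>m\<in>pos_value_group \<nu>. \<forall>g\<in>pos_value_group \<nu>. m \<le> g) \<and>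
            (\<forall>i\<in>{i\<in>{1..s}. 2 \<le> l i}.
               gauss_extension \<nu> (r i) = Fin (LEAST g. g \<in> pos_value_group \<nu>))))"
proof -
  interpret valuation \<nu>
    by fact
  interpret factored_reduction \<nu> res f \<alpha> s \<phi>bar l \<phi>
    by unfold_locales fact+
  show ?thesis
    using closed_if_squarefree closed_iff assms(16) by auto
qed

end
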